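(* Let $n>2$, and let $D_1$ and $D_2$ be connected tree diagrams on $n$ components, i.e. connected chord diagrams with $n$ components whose intersection graphs are (labeled, directed) trees. If $\Gamma(D_1)=\Gamma(D_2)$, then $D_1$ and $D_2$ are equivalent modulo the 1-term and 4-term relations.
   Context: **Chord diagrams.** A chord diagram of degree $m$ with $n$ components is a disjoint union of $n$ oriented line segments (the components, colored $1,\dots,n$) together with $m$ chords (unoriented line segments with endpoints on the components) such that the $2m$ endpoints of the chords are all distinct. A chord may have both endpoints on the same component or on two different components. The diagram is determined by the orders of the chord endpoints on each component. Endpoint $e_1$ is "below" $e_2$ if they lie on the same component and its orientation runs from $e_1$ to $e_2$. The diagram is connected if the space formed by the components together with the chords is connected. **Relations.** Consider the real vector space spanned by the chord diagrams with $n$ components, graded by degree. Two diagrams are equivalent modulo the 1-term and 4-term relations if their difference lies in the subspace spanned by the following elements. - 1-term relation: every diagram having a chord whose two endpoints lie on the same component with no other chord endpoint between them is set equal to $0$. - 4-term relation: take three disjoint arcs $\alpha,\beta,\gamma$ of the components (possibly on the same or on different components). Consider four diagrams that agree except for two chords. In all four, the first chord joins $\alpha$ to $\beta$, and the second chord has one endpoint on $\gamma$. The other endpoint of the second chord lies on $\alpha$ immediately above (diagram $D_{\alpha+}$) or immediately below (diagram $D_{\alpha-}$) the endpoint of the first chord on $\alpha$, or on $\beta$ immediately above ($D_{\beta+}$) or immediately below ($D_{\beta-}$) the endpoint of the first chord on $\beta$. No other chord has an endpoint on $\alpha,\beta,\gamma$. Then $D_{\alpha+}-D_{\alpha-}+D_{\beta+}-D_{\beta-}=0$.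 **Intersection graph.** The intersection graph $\Gamma(D)$ of a chord diagram $D$ is the following labeled directed multigraph. It has one vertex for each chord of $D$, labeled by the unordered pair $\{i,j\}$ of (labels of) the components on which the endpoints of the chord lie ($i=j$ allowed). For distinct vertices $v_1,v_2$ there is a directed edge from $v_1$ to $v_2$ for each pair $(e_1,e_2)$ where $e_1$ is an endpoint of the chord of $v_1$, $e_2$ is an endpoint of the chord of $v_2$, both lie on the same component, and $e_1$ is below $e_2$. These edges are counted mod 2, i.e. two directed edges with the same source and target cancel. If after cancellation there is a directed edge in each direction between two vertices, the two are replaced by a single undirected edge. Equality of intersection graphs means isomorphism preserving labels and edges (with directions). **Tree diagram.** A chord diagram is a tree diagram if its intersection graph is a tree, where edges may be directed or undirected; that is, the simple graph obtained by joining two vertices whenever there is a (directed or undirected) edge between them in $\Gamma(D)$ is a tree. *)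

theory Defs
  imports "HOL-Analysis.Finite_Function_Topology"
begin

section \<open>Chord diagrams\<close>

text \<open>
  A chord diagram is encoded by the list of its components; each component is the word of the
  names of the chords met when the component is traversed along its orientation. Both endpoints of
  a chord carry its name, so a word system is a chord diagram iff every name occurring in it
  occurs exactly twice in total. Components are numbered from 0.
\<close>

type_synonym word_system = "nat list list"

definition is_chord_diagram :: "nat \<Rightarrow> word_system \<Rightarrow> bool" where
  "is_chord_diagram n D \<longleftrightarrow>
     length D = n \<and> (\<forall>c \<in> set (concat D). count_list (concat D) c = 2)"

definition chords :: "word_system \<Rightarrow> nat set" where
  "chords D = set (concat D)"

text \<open>The endpoint \<open>(i, p)\<close> is the one at position \<open>p\<close> of component \<open>i\<close>.\<close>

definition endpoints :: "word_system \<Rightarrow> nat \<Rightarrow> (nat \<times> nat) set" where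
  "endpoints D c = {(i, p). i < length D \<and> p < length (D ! i) \<and> D ! i ! p = c}"

definition below :: "nat \<times> nat \<Rightarrow> nat \<times> nat \<Rightarrow> bool" where
  "below e1 e2 \<longleftrightarrow> fst e1 = fst e2 \<and> snd e1 < snd e2"

text \<open>
  The names of the chords are irrelevant: the diagram itself is the class of all word systems that
  arise by renaming.
\<close>

definition diagram_class :: "word_system \<Rightarrow> word_system set" where
  "diagram_class D = {map (map f) D | f. inj_on f (chords D)}"

text \<open>
  Components are connected intervals, and so are chords, which always meet a component; hence the
  space is connected iff any two components are linked by a sequence of chords.
\<close>

definition joined :: "word_system \<Rightarrow> nat \<Rightarrow> nat \<Rightarrow> bool" where
  "joined D i j \<longleftrightarrow> (\<exists>c \<in> chords D. i \<in> fst ` endpoints D c \<and> j \<in> fst ` endpoints D c)"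

definition connected_diagram :: "word_system \<Rightarrow> bool" where
  "connected_diagram D \<longleftrightarrow> (\<forall>i < length D. \<forall>j < length D. (joined D)\<^sup>*\<^sup>* i j)"


section \<open>Intersection graphs\<close>

text \<open>A vertex label \<open>{i, j}\<close> is an unordered pair, with \<open>{i}\<close> standing for \<open>{i, i}\<close>.\<close>

record 'v labeled_graph =
  verts :: "'v set"
  vlabel :: "'v \<Rightarrow> nat set"
  dir_edges :: "('v \<times> 'v) set"
  undir_edges :: "'v set set"

definition multiplicity_edge :: "word_system \<Rightarrow> nat \<Rightarrow> nat \<Rightarrow> nat" where
  "multiplicity_edge D v w =
     card {(e1, e2). e1 \<in> endpoints D v \<and> e2 \<in> endpoints D w \<and> below e1 e2}"

definition reduced_edge :: "word_system \<Rightarrow> nat \<Rightarrow> nat \<Rightarrow> bool" where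
  "reduced_edge D v w \<longleftrightarrow>
     v \<in> chords D \<and> w \<in> chords D \<and> v \<noteq> w \<and> odd (multiplicity_edge D v w)"

definition intersection_graph :: "word_system \<Rightarrow> nat labeled_graph" where
  "intersection_graph D =
     \<lparr> verts = chords D,
       vlabel = (\<lambda>v. fst ` endpoints D v),
       dir_edges = {(v, w). reduced_edge D v w \<and> \<not> reduced_edge D w v},
       undir_edges = {{v, w} | v w. reduced_edge D v w \<and> reduced_edge D w v} \<rparr>"

definition graph_iso :: "'v labeled_graph \<Rightarrow> 'w labeled_graph \<Rightarrow> bool" where
  "graph_iso G H \<longleftrightarrow>
     (\<exists>f. bij_betw f (verts G) (verts H) \<and>
          (\<forall>v \<in> verts G. vlabel H (f v) = vlabel G v) \<and>
          (\<forall>v \<in> verts G. \<forall>w \<in> verts G.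
             ((f v, f w) \<in> dir_edges H \<longleftrightarrow> (v, w) \<in> dir_edges G) \<and>
             ({f v, f w} \<in> undir_edges H \<longleftrightarrow> {v, w} \<in> undir_edges G)))"

definition adjacent :: "'v labeled_graph \<Rightarrow> 'v \<Rightarrow> 'v \<Rightarrow> bool" where
  "adjacent G v w \<longleftrightarrow>
     (v, w) \<in> dir_edges G \<or> (w, v) \<in> dir_edges G \<or> {v, w} \<in> undir_edges G"

definition is_cycle :: "'v labeled_graph \<Rightarrow> 'v list \<Rightarrow> bool" where
  "is_cycle G vs \<longleftrightarrow>
     length vs \<ge> 3 \<and> distinct vs \<and> set vs \<subseteq> verts G \<and>
     (\<forall>k < length vs. adjacent G (vs ! k) (vs ! (Suc k mod length vs)))"

definition is_tree :: "'v labeled_graph \<Rightarrow> bool" where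
  "is_tree G \<longleftrightarrow>
     verts G \<noteq> {} \<and>
     (\<forall>v \<in> verts G. \<forall>w \<in> verts G. (adjacent G)\<^sup>*\<^sup>* v w) \<and>
     \<not> (\<exists>vs. is_cycle G vs)"

definition tree_diagram :: "word_system \<Rightarrow> bool" where
  "tree_diagram D \<longleftrightarrow> is_tree (intersection_graph D)"


section \<open>The 1-term and 4-term relations\<close>

type_synonym diagram_space = "word_system set \<Rightarrow>\<^sub>0 real"

definition diagram_vec :: "word_system \<Rightarrow> diagram_space" where
  "diagram_vec D = Poly_Mapping.single (diagram_class D) 1"

definition one_term_relators :: "nat \<Rightarrow> diagram_space set" where
  "one_term_relators n =
     {diagram_vec D | D. is_chord_diagram n D \<and>
        (\<exists>c i p. i < n \<and> Suc p < length (D ! i) \<and> D ! i ! p = c \<and> D ! i ! Suc p = c)}"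

text \<open>
  A template is the part shared by the four diagrams of a 4-term relation, with the three arcs
  (which are disjoint and contain no endpoint of a shared chord) left as placeholders.
\<close>

datatype slot = Chord nat | Alpha | Beta | Gamma

definition is_template :: "nat \<Rightarrow> slot list list \<Rightarrow> bool" where
  "is_template n T \<longleftrightarrow>
     length T = n \<and>
     count_list (concat T) Alpha = 1 \<and>
     count_list (concat T) Beta = 1 \<and>
     count_list (concat T) Gamma = 1 \<and>
     (\<forall>c. Chord c \<in> set (concat T) \<longrightarrow> count_list (concat T) (Chord c) = 2)"

primrec fill_slot :: "nat list \<Rightarrow> nat list \<Rightarrow> nat list \<Rightarrow> slot \<Rightarrow> nat list" where
  "fill_slot u v w (Chord c) = [c]"
| "fill_slot u v w Alpha = u"
| "fill_slot u v w Beta = v"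
| "fill_slot u v w Gamma = w"

definition fill :: "slot list list \<Rightarrow> nat list \<Rightarrow> nat list \<Rightarrow> nat list \<Rightarrow> word_system" where
  "fill T u v w = map (\<lambda>xs. concat (map (fill_slot u v w) xs)) T"

text \<open>Here \<open>a\<close> is the first chord, joining \<open>\<alpha>\<close> to \<open>\<beta>\<close>, and \<open>b\<close> the second one.\<close>

definition four_term_relators :: "nat \<Rightarrow> diagram_space set" where
  "four_term_relators n =
     {diagram_vec (fill T [a, b] [a] [b]) - diagram_vec (fill T [b, a] [a] [b])
        + diagram_vec (fill T [a] [a, b] [b]) - diagram_vec (fill T [a] [b, a] [b]) | T a b.
        is_template n T \<and> a \<noteq> b \<and>
        Chord a \<notin> set (concat T) \<and> Chord b \<notin> set (concat T)}"

definition equivalent_mod_relations :: "nat \<Rightarrow> word_system \<Rightarrow> word_system \<Rightarrow> bool" where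
  "equivalent_mod_relations n D1 D2 \<longleftrightarrow>
     diagram_vec D1 - diagram_vec D2 \<in> span (one_term_relators n \<union> four_term_relators n)"

end

theory Submission
  imports Defs "HOL-Combinatorics.Transposition"
begin

text \<open>
  The statement is dualised. A vector lies in the span of the relators as soon as every linear functional that kills
  the relators kills the vector, so it suffices to compare the two diagrams under all weight systems: real functions
  on words with named chords that satisfy the 4-term identities. After renaming the chords of the second diagram along
  the graph isomorphism, both diagrams have the same chords, with the same labels and the same edges. The proof then
  starts from the chords that join two different components and adds the self chords (both ends on one component) one
  by one, in an order that keeps the intersection graph connected. At each stage the two subdiagrams agree under every
  weight system.

  The stage that adds a self chord rests on one consequence of the 4-term identities, \<open>leaf_transport\<close>.
  Let \<open>P\<close> and \<open>Q\<close> be two arcs such that every chord with an end on one of them has both ends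
  on them. A new chord with its two ends on either side of \<open>P\<close>, minus the same chord shrunk to an
  isolated one, has the same value as the analogous difference at \<open>Q\<close>. In a tree, the new self chord
  \<open>s\<close> has exactly one neighbour \<open>r\<close> among the chords already present, so the arc between its
  ends contains one end of \<open>r\<close> and otherwise complete chords. With \<open>Q\<close> the other end of
  \<open>r\<close>, the value of the diagram with \<open>s\<close> becomes an expression in the diagram without
  \<open>s\<close>, depending only on \<open>s\<close>, \<open>r\<close> and the component of \<open>s\<close>
  (\<open>flat_insert_self_chord\<close>). That expression is again a weight system of the smaller diagram
  (\<open>weight_system_attach_leaf\<close>), so the two smaller diagrams agree under it. All nesting and ordering of
  the branches of the tree is thereby absorbed.

  It remains to compare the chords that join two components. With at least three components, two such chords with the
  same label have a common neighbour, hence are not adjacent, hence are parallel. Chords with different labels are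
  ordered on a common component by the direction of their edge. So the two subdiagrams differ only in the order of
  parallel chords, and adjacent parallel chords can be exchanged (\<open>swap_parallel_chords\<close>,
  \<open>reorder_parallel_chords\<close>).
\<close>

section \<open>Weight systems on words of named chords\<close>

text \<open>
  One arc or several arcs in a row that contain both ends of each of their chords.
\<close>

definition closed_word :: "'a option list \<Rightarrow> bool" where
  "closed_word B \<longleftrightarrow> None \<notin> set B \<and> (\<forall>x \<in> set B. count_list B x = 2)"

text \<open>
  A letter \<open>Some c\<close> is an end of the chord \<open>c\<close> and \<open>None\<close> separates consecutive components. The identity
  is demanded for all words: a function that vanishes on words that are not chord diagrams satisfies it
  there trivially, because the four words have the same letters. The other end of \<open>e\<close> may sit anywhere
  in \<open>u\<close>, \<open>z\<close> or \<open>w\<close>, so one formula covers every order of the three arcs.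
\<close>

definition weight_system :: "('a option list \<Rightarrow> real) \<Rightarrow> bool" where
  "weight_system \<phi> \<longleftrightarrow> (\<forall>u z w a e. a \<noteq> e \<longrightarrow>
     \<phi> (u @ [Some a, Some e] @ z @ [Some a] @ w) - \<phi> (u @ [Some e, Some a] @ z @ [Some a] @ w)
     + \<phi> (u @ [Some a] @ z @ [Some a, Some e] @ w) - \<phi> (u @ [Some a] @ z @ [Some e, Some a] @ w) = 0)"

lemma weight_systemD:
  assumes "weight_system \<phi>" "a \<noteq> e"
  shows "\<phi> (u @ [Some a, Some e] @ z @ [Some a] @ w) - \<phi> (u @ [Some e, Some a] @ z @ [Some a] @ w)
     + \<phi> (u @ [Some a] @ z @ [Some a, Some e] @ w) - \<phi> (u @ [Some a] @ z @ [Some e, Some a] @ w) = 0"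
  using assms unfolding weight_system_def by blast

text \<open>
  The 4-term identity in terms of jumps: when \<open>e\<close> moves through \<open>M\<close>, its jumps over the two ends of one
  chord cancel. In this form the identities can be added up over several chords.
\<close>

lemma jump_pair:
  assumes ws: "weight_system \<phi>" and "p < q" "q < length M" "M ! p = Some a" "M ! q = Some a" "a \<noteq> e"
  defines "I \<equiv> \<lambda>k. take k M @ Some e # drop k M"
  shows "(\<phi> (I (Suc p)) - \<phi> (I p)) + (\<phi> (I (Suc q)) - \<phi> (I q)) = 0"
proof -
  define u where "u = take p M"
  define z where "z = take (q - Suc p) (drop (Suc p) M)"
  define w where "w = drop (Suc q) M"
  have d1: "drop (Suc p) M = z @ Some a # w"
  proof -
    have "drop (Suc p) M = z @ drop (q - Suc p) (drop (Suc p) M)"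
      unfolding z_def by (rule append_take_drop_id[symmetric])
    also have "drop (q - Suc p) (drop (Suc p) M) = drop q M"
      using assms(2) by simp
    also have "drop q M = Some a # w"
      unfolding w_def using Cons_nth_drop_Suc[OF assms(3)] unfolding assms(5) by (rule sym)
    finally show ?thesis .
  qed
  have M: "M = u @ Some a # z @ Some a # w"
  proof -
    have "M = take p M @ M ! p # drop (Suc p) M"
      by (rule id_take_nth_drop) (use assms(2,3) in linarith)
    then show ?thesis unfolding u_def[symmetric] d1 assms(4) by simp
  qed
  have lu: "length u = p" using assms(2,3) u_def by simp
  have lz: "length z = q - Suc p" using assms(2,3) z_def by simp
  have "q = length (u @ Some a # z)" using lu lz assms(2) by simp
  then have t: "take q M = u @ Some a # z" "drop q M = Some a # w"
    "take (Suc q) M = u @ Some a # z @ [Some a]" "drop (Suc q) M = w"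
    "take p M = u" "drop p M = Some a # z @ Some a # w"
    "take (Suc p) M = u @ [Some a]" "drop (Suc p) M = z @ Some a # w"
    using M lu by auto
  show ?thesis
    unfolding I_def t using weight_systemD[OF ws assms(6), of u z w] by simp
qed

lemma card_positions:
  "card {k \<in> {length u..<length u + length B}. (u @ B @ w) ! k = x} = count_list B x"
proof -
  have "{k \<in> {length u..<length u + length B}. (u @ B @ w) ! k = x}
      = (\<lambda>j. length u + j) ` {j. j < length B \<and> B ! j = x}"
  proof (intro set_eqI iffI)
    fix k assume "k \<in> {k \<in> {length u..<length u + length B}. (u @ B @ w) ! k = x}"
    then show "k \<in> (\<lambda>j. length u + j) ` {j. j < length B \<and> B ! j = x}"
      by (intro image_eqI[of _ _ "k - length u"]) (auto simp: nth_append split: if_splits)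
  qed (auto simp: nth_append)
  then have "card {k \<in> {length u..<length u + length B}. (u @ B @ w) ! k = x}
      = card {j. j < length B \<and> B ! j = x}"
    by (simp add: card_image)
  also have "\<dots> = length (filter (\<lambda>y. y = x) B)"
    by (rule length_filter_conv_card[symmetric])
  also have "\<dots> = count_list B x" by (induction B) auto
  finally show ?thesis .
qed

text \<open>
  The jumps of \<open>e\<close> over all letters of \<open>B1\<close> and \<open>B2\<close> add up to \<open>0\<close>, since these letters are the
  ends of complete chords and the two jumps over each chord cancel; on each arc the sum telescopes.
\<close>

lemma kirchhoff:
  assumes ws: "weight_system \<phi>" and cl: "closed_word (B1 @ B2)" and e: "Some e \<notin> set (B1 @ B2)"
  shows "\<phi> (u @ B1 @ Some e # z @ B2 @ w) - \<phi> (u @ Some e # B1 @ z @ B2 @ w)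
       + \<phi> (u @ B1 @ z @ B2 @ Some e # w) - \<phi> (u @ B1 @ z @ Some e # B2 @ w) = 0"
proof -
  define M where "M = u @ B1 @ z @ B2 @ w"
  define I where "I = (\<lambda>k. take k M @ Some e # drop k M)"
  \<comment> \<open>the change of value when \<open>e\<close> jumps over the letter at position \<open>k\<close>\<close>
  define J where "J = (\<lambda>k. \<phi> (I (Suc k)) - \<phi> (I k))"
  define p1 where "p1 = length u"
  define q1 where "q1 = length u + length B1"
  define p2 where "p2 = length (u @ B1 @ z)"
  define q2 where "q2 = length (u @ B1 @ z) + length B2"
  define K1 where "K1 = {p1..<q1}"
  define K2 where "K2 = {p2..<q2}"
  have fin: "finite (K1 \<union> K2)" and disj: "K1 \<inter> K2 = {}"
    by (auto simp: K1_def K2_def p1_def q1_def p2_def q2_def)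
  have lenM: "k < length M" if "k \<in> K1 \<union> K2" for k
    using that by (auto simp: K1_def K2_def p1_def q1_def p2_def q2_def M_def)
  have c1: "card {k \<in> K1. M ! k = x} = count_list B1 x" for x
    using card_positions[of u B1 "z @ B2 @ w" x] by (simp add: K1_def p1_def q1_def M_def)
  have c2: "card {k \<in> K2. M ! k = x} = count_list B2 x" for x
    using card_positions[of "u @ B1 @ z" B2 w x] by (simp add: K2_def p2_def q2_def M_def)
  have c: "card {k \<in> K1 \<union> K2. M ! k = x} = count_list (B1 @ B2) x" for x
  proof -
    have "{k \<in> K1 \<union> K2. M ! k = x} = {k \<in> K1. M ! k = x} \<union> {k \<in> K2. M ! k = x}" by auto
    moreover have "card \<dots> = card {k \<in> K1. M ! k = x} + card {k \<in> K2. M ! k = x}"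
      using disj fin by (intro card_Un_disjoint) (simp_all add: disjoint_iff)
    ultimately show ?thesis
      using c1[of x] c2[of x] by (simp only: count_list_append)
  qed
  have img: "(\<lambda>k. M ! k) ` (K1 \<union> K2) \<subseteq> set (B1 @ B2)"
  proof (intro image_subsetI)
    fix k assume k: "k \<in> K1 \<union> K2"
    then have "{j \<in> K1 \<union> K2. M ! j = M ! k} \<noteq> {}" by blast
    then have "card {j \<in> K1 \<union> K2. M ! j = M ! k} \<noteq> 0" using fin by simp
    then have "count_list (B1 @ B2) (M ! k) \<noteq> 0" unfolding c .
    then show "M ! k \<in> set (B1 @ B2)" unfolding count_list_0_iff by (rule notnotD)
  qed
  have "sum J (K1 \<union> K2) = (\<Sum>x\<in>set (B1 @ B2). sum J {k \<in> K1 \<union> K2. M ! k = x})"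
    using sum.group[OF fin _ img, of J] by (rule sym) (rule finite_set)
  also have "\<dots> = 0"
  proof (rule sum.neutral, rule ballI)
    fix x assume x: "x \<in> set (B1 @ B2)"
    have "x \<noteq> None" using x cl unfolding closed_word_def by metis
    moreover have "x \<noteq> Some e" using x e by metis
    ultimately obtain a where a: "x = Some a" "a \<noteq> e" by (cases x) simp_all
    have "card {k \<in> K1 \<union> K2. M ! k = x} = 2" using c x cl unfolding closed_word_def by simp
    then obtain p q where pq: "{k \<in> K1 \<union> K2. M ! k = x} = {p, q}" "p \<noteq> q"
      unfolding card_2_iff by blast
    have "p \<in> {k \<in> K1 \<union> K2. M ! k = x}" "q \<in> {k \<in> K1 \<union> K2. M ! k = x}"
      unfolding pq(1) by simp_all
    then have pq': "p < length M" "q < length M" "M ! p = Some a" "M ! q = Some a"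
      using lenM a(1) by simp_all
    have *: "J p + J q = 0"
    proof (cases "p < q")
      case True
      show ?thesis unfolding J_def I_def
        by (rule jump_pair[OF ws True pq'(2,3,4) a(2)])
    next
      case False
      then have "q < p" using pq by simp
      have "J q + J p = 0"
        unfolding J_def I_def
        by (rule jump_pair[OF ws \<open>q < p\<close> pq'(1,4,3) a(2)])
      then show ?thesis by simp
    qed
    then show "sum J {k \<in> K1 \<union> K2. M ! k = x} = 0" using pq by simp
  qed
  finally have "sum J K1 + sum J K2 = 0"
    using fin disj by (simp add: sum.union_disjoint)
  moreover have "sum J K1 = \<phi> (I q1) - \<phi> (I p1)"
    unfolding J_def K1_def by (rule sum_Suc_diff') (simp add: p1_def q1_def)
  moreover have "sum J K2 = \<phi> (I q2) - \<phi> (I p2)"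
    unfolding J_def K2_def by (rule sum_Suc_diff') (simp add: p2_def q2_def)
  moreover have "I p1 = u @ Some e # B1 @ z @ B2 @ w" "I q1 = u @ B1 @ Some e # z @ B2 @ w"
    "I p2 = u @ B1 @ z @ Some e # B2 @ w" "I q2 = u @ B1 @ z @ B2 @ Some e # w"
    by (auto simp: I_def p1_def q1_def p2_def q2_def M_def)
  ultimately show ?thesis by simp
qed

text \<open>
  This is the 4-term identity for the chord \<open>s\<close> with its two arcs side by side: the inner terms cancel.
\<close>

lemma slide_isolated_chord_letter:
  assumes ws: "weight_system \<phi>" and "e \<noteq> s"
  shows "\<phi> (u @ [Some s, Some s] @ Some e # w) = \<phi> (u @ Some e # [Some s, Some s] @ w)"
  using kirchhoff[OF ws, of "[Some s, Some s]" "[]" e u "[]" w] assms(2)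
  by (simp add: closed_word_def)

lemma slide_isolated_chord:
  assumes ws: "weight_system \<phi>" and "None \<notin> set x" "Some s \<notin> set x"
  shows "\<phi> (u @ [Some s, Some s] @ x @ w) = \<phi> (u @ x @ [Some s, Some s] @ w)"
  using assms(2,3)
proof (induction x arbitrary: u)
  case (Cons y x)
  then obtain e where y: "y = Some e" "e \<noteq> s" by (cases y) auto
  show ?case
    using slide_isolated_chord_letter[OF ws y(2), of u "x @ w"] Cons.IH[of "u @ [y]"] Cons.prems y
    by simp
qed simp

text \<open>
  One end of \<open>s\<close> slides over \<open>P\<close> and \<open>Q\<close> while its other end stays fixed on one of the four sides of the
  two arcs. The two relations with the fixed end next to \<open>P\<close> add up to twice the left-hand side, the two
  with the fixed end next to \<open>Q\<close> to twice the right-hand side (an isolated chord may pass over a whole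
  arc), and both sums involve the same four configurations with one end of \<open>s\<close> at each arc.
\<close>

lemma leaf_transport:
  assumes ws: "weight_system \<phi>" and cl: "closed_word (P @ Q)" and s: "Some s \<notin> set (P @ Q)"
  shows "\<phi> (u @ [Some s] @ P @ [Some s] @ z @ Q @ w) - \<phi> (u @ [Some s, Some s] @ P @ z @ Q @ w)
       = \<phi> (u @ P @ z @ [Some s] @ Q @ [Some s] @ w) - \<phi> (u @ P @ z @ [Some s, Some s] @ Q @ w)"
proof -
  have N: "None \<notin> set P" "None \<notin> set Q" "Some s \<notin> set P" "Some s \<notin> set Q"
    using cl s unfolding closed_word_def by auto
  note K = kirchhoff[OF ws cl s]
  have 1: "\<phi> (u @ [Some s, Some s] @ P @ z @ Q @ w) = \<phi> (u @ P @ [Some s, Some s] @ z @ Q @ w)"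
    using slide_isolated_chord[OF ws N(1,3), of u "z @ Q @ w"] by simp
  have 2: "\<phi> (u @ P @ z @ [Some s, Some s] @ Q @ w) = \<phi> (u @ P @ z @ Q @ [Some s, Some s] @ w)"
    using slide_isolated_chord[OF ws N(2,4), of "u @ P @ z" w] by simp
  show ?thesis
    using 1 2 K[of "u @ [Some s]" z w] K[of u "Some s # z" w] K[of u "z @ [Some s]" w]
      K[of u z "Some s # w"]
    unfolding append.simps append_assoc by linarith
qed

text \<open>
  The chord \<open>b\<close> commutes with the sum over all ways to put each end of \<open>a\<close> on one of the two strands:
  each end alone slides over both ends of \<open>b\<close>. The terms with both ends of \<open>a\<close> on one strand are
  isolated chords and commute with \<open>b\<close> by themselves; the other two terms are equal to each other.
\<close>

lemma swap_parallel_chords: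
  assumes ws: "weight_system \<phi>" and ab: "a \<noteq> b"
  shows "\<phi> (u @ [Some a, Some b] @ z @ [Some a, Some b] @ w)
       = \<phi> (u @ [Some b, Some a] @ z @ [Some b, Some a] @ w)"
proof -
  note K = weight_systemD[OF ws ab[symmetric]]
  have 1: "\<phi> (u @ [Some a, Some a] @ Some b # z @ [Some b] @ w)
      = \<phi> (u @ Some b # [Some a, Some a] @ z @ [Some b] @ w)"
    using slide_isolated_chord_letter[OF ws ab[symmetric], of u "z @ [Some b] @ w"] by simp
  have 2: "\<phi> (u @ [Some b] @ z @ [Some a, Some a] @ Some b # w)
      = \<phi> (u @ [Some b] @ z @ Some b # [Some a, Some a] @ w)"
    using slide_isolated_chord_letter[OF ws ab[symmetric], of "u @ [Some b] @ z" w] by simp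
  show ?thesis
    using 1 2 K[of "u @ [Some a]" z w] K[of u "Some a # z" w] K[of u "z @ [Some a]" w]
      K[of u z "Some a # w"]
    unfolding append.simps append_assoc by linarith
qed

section \<open>Attaching a leaf preserves weight systems\<close>

text \<open>
  The word \<open>m\<close> is put at the start of component \<open>i\<close>. This spot is
  never between two letters that a 4-term identity exchanges, so the insertion commutes with the identity.
\<close>

primrec insert_in_component :: "nat \<Rightarrow> 'a option list \<Rightarrow> 'a option list \<Rightarrow> 'a option list" where
  "insert_in_component i m [] = (if i = 0 then m else [])"
| "insert_in_component i m (x # xs) =
     (if i = 0 then m @ x # xs
      else x # insert_in_component (if x = None then i - 1 else i) m xs)"

lemma insert_in_component_0 [simp]: "insert_in_component 0 m xs = m @ xs"
  by (cases xs) auto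

lemma insert_in_component_append:
  "(\<exists>u1 u2. u = u1 @ u2 \<and> (\<forall>v. insert_in_component i m (u @ v) = u1 @ m @ u2 @ v)) \<or>
   (\<exists>j>0. \<forall>v. insert_in_component i m (u @ v) = u @ insert_in_component j m v)"
proof (induction u arbitrary: i)
  case Nil
  then show ?case by (cases "i = 0") auto
next
  case (Cons x u)
  show ?case
  proof (cases "i = 0")
    case True
    then have "x # u = [] @ (x # u) \<and> (\<forall>v. insert_in_component i m ((x # u) @ v) = [] @ m @ (x # u) @ v)"
      by simp
    then show ?thesis by blast
  next
    case False
    let ?i = "if x = None then i - 1 else i"
    have *: "insert_in_component i m ((x # u) @ v) = x # insert_in_component ?i m (u @ v)" for v
      using False by simp
    from Cons.IH[of ?i] show ?thesis
    proof (elim disjE exE conjE)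
      fix u1 u2
      assume u: "u = u1 @ u2" and "\<forall>v. insert_in_component ?i m (u @ v) = u1 @ m @ u2 @ v"
      then have "x # u = (x # u1) @ u2 \<and>
          (\<forall>v. insert_in_component i m ((x # u) @ v) = (x # u1) @ m @ u2 @ v)"
        unfolding * by simp
      then show ?thesis by blast
    next
      fix j assume "0 < j" "\<forall>v. insert_in_component ?i m (u @ v) = u @ insert_in_component j m v"
      then show ?thesis unfolding * by auto
    qed
  qed
qed

text \<open>
  The value that \<open>\<phi>\<close> gives to a diagram in which \<open>s\<close> is a leaf at \<open>r\<close> with both ends on component \<open>i\<close>,
  expressed through the diagram \<open>D\<close> without \<open>s\<close>. The chosen end of \<open>r\<close> is irrelevant only for the
  difference of the two terms in which \<open>s\<close> sits at \<open>r\<close>; hence the isolated chord is subtracted there and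
  added back on the component where \<open>s\<close> belongs. The conditions for the value \<open>0\<close> depend only on the
  letters of \<open>D\<close>, so they hold for all four words of a 4-term identity or for none.
\<close>

definition attach_leaf ::
    "('a option list \<Rightarrow> real) \<Rightarrow> 'a \<Rightarrow> 'a \<Rightarrow> nat \<Rightarrow> 'a option list \<Rightarrow> real" where
  "attach_leaf \<phi> s r i D =
     (if Some s \<in> set D \<or> count_list D (Some r) \<noteq> 2 then 0
      else (let (U, V) = (SOME (U, V). D = U @ Some r # V) in
              \<phi> (U @ [Some s, Some r, Some s] @ V) - \<phi> (U @ [Some s, Some s, Some r] @ V))
           + \<phi> (insert_in_component i [Some s, Some s] D))"

text \<open>
  This is \<open>leaf_transport\<close> with the two ends of \<open>r\<close> as the arcs; it makes the choice in \<open>attach_leaf\<close>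
  immaterial.
\<close>

lemma leaf_either_endpoint:
  assumes ws: "weight_system \<phi>" and "s \<noteq> r" and c: "count_list D (Some r) = 2"
    and "D = U @ Some r # V" "D = U' @ Some r # V'"
  shows "\<phi> (U @ [Some s, Some r, Some s] @ V) - \<phi> (U @ [Some s, Some s, Some r] @ V)
       = \<phi> (U' @ [Some s, Some r, Some s] @ V') - \<phi> (U' @ [Some s, Some s, Some r] @ V')"
proof -
  have *: "\<phi> (u @ [Some s, Some r, Some s] @ z @ Some r # w) - \<phi> (u @ [Some s, Some s, Some r] @ z @ Some r # w)
      = \<phi> (u @ Some r # z @ [Some s, Some r, Some s] @ w) - \<phi> (u @ Some r # z @ [Some s, Some s, Some r] @ w)"
    for u z w
    using leaf_transport[OF ws, of "[Some r]" "[Some r]" s u z w] assms(2)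
    by (simp add: closed_word_def)
  obtain us where "U = U' @ us \<and> us @ Some r # V = Some r # V' \<or> U @ us = U' \<and> Some r # V = us @ Some r # V'"
    using assms(4,5) append_eq_append_conv2[of U "Some r # V" U' "Some r # V'"] by auto
  then consider "U = U' \<and> V = V'"
    | z where "U = U' @ Some r # z" "V' = z @ Some r # V"
    | z where "U' = U @ Some r # z" "V = z @ Some r # V'"
    by (cases us) auto
  then show ?thesis
  proof cases
    case 2
    then show ?thesis using *[of U' z V] by simp
  next
    case 3
    then show ?thesis using *[of U z V'] by simp
  qed simp
qed

lemma attach_leaf_eq:
  assumes ws: "weight_system \<phi>" and "s \<noteq> r" and c: "count_list D (Some r) = 2"
    and "Some s \<notin> set D" and D: "D = U @ Some r # V"
  shows "attach_leaf \<phi> s r i D = \<phi> (U @ [Some s, Some r, Some s] @ V)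
     - \<phi> (U @ [Some s, Some s, Some r] @ V) + \<phi> (insert_in_component i [Some s, Some s] D)"
proof -
  obtain U' V' where UV: "(SOME (U, V). D = U @ Some r # V) = (U', V')" by (cases "SOME (U, V). D = U @ Some r # V") auto
  have "case (SOME (U, V). D = U @ Some r # V) of (U, V) \<Rightarrow> D = U @ Some r # V"
    by (rule someI[of "\<lambda>(U, V). D = U @ Some r # V" "(U, V)"]) (simp add: D)
  then have "D = U' @ Some r # V'" unfolding UV by simp
  from leaf_either_endpoint[OF ws assms(2) c this D]
  show ?thesis unfolding attach_leaf_def UV using c assms(4) by simp
qed

text \<open>
  In a 4-term identity for the chords \<open>a\<close> and \<open>e\<close> the leaf can be kept at an end of \<open>r\<close> that does not
  move, and then the identity for \<open>\<phi>\<close> applies to the words with the leaf included. If \<open>r\<close> is the chord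
  \<open>a\<close> over which \<open>e\<close> slides, then \<open>e\<close> has to slide over the end of \<open>a\<close> together with the leaf, which
  \<open>kirchhoff\<close> allows. If \<open>r\<close> is the sliding chord \<open>e\<close>, the leaf goes to its other end.
\<close>

lemma weight_system_attach_leaf:
  assumes ws: "weight_system \<phi>" and sr: "s \<noteq> r"
  shows "weight_system (attach_leaf \<phi> s r i)"
  unfolding weight_system_def
proof (intro allI impI)
  fix u z w :: "'a option list" and a e :: 'a
  assume ae: "a \<noteq> e"
  let ?m = "[Some s, Some s]"
  let ?A = "attach_leaf \<phi> s r i"
  define W1 where "W1 = u @ [Some a, Some e] @ z @ [Some a] @ w"
  define W2 where "W2 = u @ [Some e, Some a] @ z @ [Some a] @ w"
  define W3 where "W3 = u @ [Some a] @ z @ [Some a, Some e] @ w"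
  define W4 where "W4 = u @ [Some a] @ z @ [Some e, Some a] @ w"
  note W = W1_def W2_def W3_def W4_def
  have sets: "set W2 = set W1" "set W3 = set W1" "set W4 = set W1"
    by (auto simp: W)
  have cnt: "count_list W2 x = count_list W1 x" "count_list W3 x = count_list W1 x"
    "count_list W4 x = count_list W1 x" for x
    by (simp_all add: W)
  have "?A W1 - ?A W2 + ?A W3 - ?A W4 = 0"
  proof (cases "Some s \<in> set W1 \<or> count_list W1 (Some r) \<noteq> 2")
    case True
    then show ?thesis unfolding attach_leaf_def using sets cnt by simp
  next
    case False
    then have s: "Some s \<notin> set W1" and c: "count_list W1 (Some r) = 2" by auto
    have sae: "s \<noteq> a" "s \<noteq> e" using s by (auto simp: W)
    note E = attach_leaf_eq[OF ws sr c s] attach_leaf_eq[OF ws sr, of W2, unfolded sets cnt, OF c s]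
      attach_leaf_eq[OF ws sr, of W3, unfolded sets cnt, OF c s]
      attach_leaf_eq[OF ws sr, of W4, unfolded sets cnt, OF c s]
    define Y where "Y = (\<lambda>x. \<phi> (insert_in_component i ?m x))"
    \<comment> \<open>the contribution of the isolated chord, according to where component \<open>i\<close> starts\<close>
    have Y: "Y W1 - Y W2 + Y W3 - Y W4 = 0"
      using insert_in_component_append[where u = u and i = i and m = ?m]
    proof (elim disjE exE conjE)
      fix u1 u2
      assume "u = u1 @ u2" "\<forall>v. insert_in_component i ?m (u @ v) = u1 @ ?m @ u2 @ v"
      then show ?thesis
        unfolding W Y_def using weight_systemD[OF ws ae, of "u1 @ ?m @ u2" z w] by simp
    next
      fix j assume j: "j > 0" "\<forall>v. insert_in_component i ?m (u @ v) = u @ insert_in_component j ?m v"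
      from insert_in_component_append[where u = z and i = j and m = ?m] show ?thesis
      proof (elim disjE exE conjE)
        fix u1 u2
        assume "z = u1 @ u2" "\<forall>v. insert_in_component j ?m (z @ v) = u1 @ ?m @ u2 @ v"
        then show ?thesis
          unfolding W Y_def using j weight_systemD[OF ws ae, of u "u1 @ ?m @ u2" w] by simp
      next
        fix k assume "k > 0" "\<forall>v. insert_in_component j ?m (z @ v) = z @ insert_in_component k ?m v"
        then show ?thesis
          unfolding W Y_def using j weight_systemD[OF ws ae, of u z "insert_in_component k ?m w"] by simp
      qed
    qed
    show ?thesis
    proof (cases "r = a")
      case True
      have K: "\<phi> (u @ m @ Some e # z @ [Some a] @ w) - \<phi> (u @ Some e # m @ z @ [Some a] @ w)
       + \<phi> (u @ m @ z @ [Some a] @ Some e # w) - \<phi> (u @ m @ z @ Some e # [Some a] @ w) = 0"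
        if "m = [Some s, Some a, Some s] \<or> m = [Some s, Some s, Some a]" for m
        by (rule kirchhoff[OF ws]) (use that ae sae in \<open>auto simp: closed_word_def\<close>)
      show ?thesis
        using K[of "[Some s, Some a, Some s]"] K[of "[Some s, Some s, Some a]"] Y
          E(1)[of u "[Some e] @ z @ [Some a] @ w"] E(2)[of "u @ [Some e]" "z @ [Some a] @ w"]
          E(3)[of u "z @ [Some a, Some e] @ w"] E(4)[of u "z @ [Some e, Some a] @ w"]
        unfolding Y_def True by (simp add: W True)
    next
      case False
      \<comment> \<open>an end of \<open>r\<close> that stays fixed; for \<open>r = e\<close> it exists since \<open>e\<close> is displayed only once\<close>
      have "Some r \<in> set u \<or> Some r \<in> set z \<or> Some r \<in> set w"
      proof (rule ccontr)
        assume "\<not> ?thesis"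
        then have "count_list W1 (Some r) \<le> 1"
          using False by (simp add: W1_def)
        then show False using c by simp
      qed
      then show ?thesis
      proof (elim disjE)
        assume "Some r \<in> set u"
        then obtain u1 u2 where u: "u = u1 @ Some r # u2" by (meson split_list)
        show ?thesis
          using weight_systemD[OF ws ae, of "u1 @ [Some s, Some r, Some s] @ u2" z w]
            weight_systemD[OF ws ae, of "u1 @ [Some s, Some s, Some r] @ u2" z w] Y
            E(1)[of u1 "u2 @ [Some a, Some e] @ z @ [Some a] @ w"]
            E(2)[of u1 "u2 @ [Some e, Some a] @ z @ [Some a] @ w"]
            E(3)[of u1 "u2 @ [Some a] @ z @ [Some a, Some e] @ w"]
            E(4)[of u1 "u2 @ [Some a] @ z @ [Some e, Some a] @ w"]
          unfolding Y_def by (simp add: W u)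
      next
        assume "Some r \<in> set z"
        then obtain u1 u2 where z: "z = u1 @ Some r # u2" by (meson split_list)
        show ?thesis
          using weight_systemD[OF ws ae, of u "u1 @ [Some s, Some r, Some s] @ u2" w]
            weight_systemD[OF ws ae, of u "u1 @ [Some s, Some s, Some r] @ u2" w] Y
            E(1)[of "u @ [Some a, Some e] @ u1" "u2 @ [Some a] @ w"]
            E(2)[of "u @ [Some e, Some a] @ u1" "u2 @ [Some a] @ w"]
            E(3)[of "u @ [Some a] @ u1" "u2 @ [Some a, Some e] @ w"]
            E(4)[of "u @ [Some a] @ u1" "u2 @ [Some e, Some a] @ w"]
          unfolding Y_def by (simp add: W z)
      next
        assume "Some r \<in> set w"
        then obtain u1 u2 where w: "w = u1 @ Some r # u2" by (meson split_list)
        show ?thesis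
          using weight_systemD[OF ws ae, of u z "u1 @ [Some s, Some r, Some s] @ u2"]
            weight_systemD[OF ws ae, of u z "u1 @ [Some s, Some s, Some r] @ u2"] Y
            E(1)[of "u @ [Some a, Some e] @ z @ [Some a] @ u1" u2]
            E(2)[of "u @ [Some e, Some a] @ z @ [Some a] @ u1" u2]
            E(3)[of "u @ [Some a] @ z @ [Some a, Some e] @ u1" u2]
            E(4)[of "u @ [Some a] @ z @ [Some e, Some a] @ u1" u2]
          unfolding Y_def by (simp add: W w)
      qed
    qed
  qed
  then show "?A (u @ [Some a, Some e] @ z @ [Some a] @ w) - ?A (u @ [Some e, Some a] @ z @ [Some a] @ w)
     + ?A (u @ [Some a] @ z @ [Some a, Some e] @ w) - ?A (u @ [Some a] @ z @ [Some e, Some a] @ w) = 0"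
    unfolding W .
qed

text \<open>
  The components one after the other, with separators only between them: the first one of the
  concatenation is dropped.
\<close>

definition flat :: "'a list list \<Rightarrow> 'a option list" where
  "flat D = tl (concat (map (\<lambda>w. None # map Some w) D))"

lemma flat_context:
  "flat (D1 @ w # D2) = concat (map (\<lambda>w. map Some w @ [None]) D1) @ map Some w
     @ concat (map (\<lambda>w. None # map Some w) D2)"
proof -
  have "concat (map (\<lambda>w. None # map Some w) (D1 @ w # D2)) =
     None # concat (map (\<lambda>w. map Some w @ [None]) D1) @ map Some w
     @ concat (map (\<lambda>w. None # map Some w) D2)"
    by (induction D1) auto
  then show ?thesis unfolding flat_def by (simp only: list.sel)
qed

lemma count_list_flat [simp]: "count_list (flat D) (Some c) = count_list (concat D) c"
proof -
  have "count_list (map Some w) (Some c) = count_list w c" for w :: "'a list"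
    by (induction w) auto
  then have "count_list (concat (map (\<lambda>w. None # map Some w) D)) (Some c) = count_list (concat D) c"
    by (induction D) auto
  then show ?thesis unfolding flat_def by (cases D) auto
qed

lemma insert_in_component_flat:
  "insert_in_component (length D1) m (concat (map (\<lambda>w. map Some w @ [None]) D1) @ v)
     = concat (map (\<lambda>w. map Some w @ [None]) D1) @ m @ v"
proof (induction D1)
  case (Cons x D1)
  have "insert_in_component (Suc j) m (map Some x @ v) = map Some x @ insert_in_component (Suc j) m v" for j v
    by (induction x) auto
  then show ?case using Cons by simp
qed simp

text \<open>
  The chord \<open>s\<close> encloses the arc \<open>y\<close>, which contains one end of \<open>r\<close> and otherwise complete chords. So \<open>y\<close>
  and the other end of \<open>r\<close> are two arcs for \<open>leaf_transport\<close>: the whole content of \<open>y\<close>, however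
  complicated, can be replaced by a single end of \<open>r\<close>.
\<close>

lemma attach_leaf_flat:
  fixes D1 D2 :: "'a list list"
  assumes ws: "weight_system \<phi>" and sr: "s \<noteq> r"
    and D': "D' = D1 @ (x @ y @ t) # D2"
    and s: "s \<notin> set (concat D')" and r: "count_list (concat D') r = 2"
    and ry: "count_list y r = 1" and y: "\<And>c. c \<in> set y \<Longrightarrow> c \<noteq> r \<Longrightarrow> count_list y c = 2"
  shows "\<phi> (flat (D1 @ (x @ [s] @ y @ [s] @ t) # D2)) = attach_leaf \<phi> s r (length D1) (flat D')"
proof -
  define pre where "pre = concat (map (\<lambda>w. map Some w @ [None :: 'a option]) D1)"
  define U where "U = pre @ map Some x"
  define Y where "Y = map Some y"
  define V where "V = map Some t @ concat (map (\<lambda>w. None # map Some w) D2)"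
  have D: "flat (D1 @ (x @ [s] @ y @ [s] @ t) # D2) = U @ [Some s] @ Y @ [Some s] @ V"
    by (simp add: flat_context U_def pre_def Y_def V_def)
  have fD': "flat D' = U @ Y @ V"
    by (simp add: D' flat_context U_def pre_def Y_def V_def)
  have c: "count_list (flat D') (Some r) = 2" using r by simp
  have s': "Some s \<notin> set (flat D')"
    using s unfolding count_list_0_iff[symmetric] count_list_flat .
  have ins: "insert_in_component (length D1) [Some s, Some s] (flat D')
      = pre @ [Some s, Some s] @ map Some x @ Y @ V"
    unfolding fD' U_def append_assoc pre_def by (rule insert_in_component_flat)
  have slide: "\<phi> (pre @ [Some s, Some s] @ map Some x @ Y @ V) = \<phi> (U @ [Some s, Some s] @ Y @ V)"
    using slide_isolated_chord[OF ws, of "map Some x" s pre "Y @ V"] s D' by (auto simp: U_def)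
  have cm: "count_list (map Some w) (Some d) = count_list w d" for w and d :: 'a
    by (induction w) auto
  have cY: "count_list Y (Some r) = 1" using ry by (simp add: Y_def cm)
  then have "count_list (U @ V) (Some r) = 1" using c unfolding fD' by simp
  then have "count_list (U @ V) (Some r) \<noteq> 0" by simp
  then have "Some r \<in> set (U @ V)" unfolding count_list_0_iff by simp
  then consider "Some r \<in> set U" | "Some r \<in> set V" by auto
  moreover have closed: "closed_word ([Some r] @ Y)" "closed_word (Y @ [Some r])"
    using cY y by (auto simp: closed_word_def Y_def cm)
  moreover have sY: "Some s \<notin> set ([Some r] @ Y)" "Some s \<notin> set (Y @ [Some r])" using s' sr unfolding fD' by auto
  ultimately show ?thesis
  proof cases
    case 1
    then obtain U1 U2 where U: "U = U1 @ Some r # U2" by (meson split_list)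
    have "attach_leaf \<phi> s r (length D1) (flat D')
        = \<phi> (U1 @ [Some s, Some r, Some s] @ U2 @ Y @ V) - \<phi> (U1 @ [Some s, Some s, Some r] @ U2 @ Y @ V)
          + \<phi> (insert_in_component (length D1) [Some s, Some s] (flat D'))"
      by (rule attach_leaf_eq[OF ws sr c s']) (simp add: fD' U)
    then show ?thesis
      using leaf_transport[OF ws closed(1) sY(1), of U1 U2 V]
      unfolding D ins slide by (simp add: U)
  next
    case 2
    then obtain V1 V2 where V: "V = V1 @ Some r # V2" by (meson split_list)
    have "attach_leaf \<phi> s r (length D1) (flat D')
        = \<phi> ((U @ Y @ V1) @ [Some s, Some r, Some s] @ V2) - \<phi> ((U @ Y @ V1) @ [Some s, Some s, Some r] @ V2)
          + \<phi> (insert_in_component (length D1) [Some s, Some s] (flat D'))"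
      by (rule attach_leaf_eq[OF ws sr c s']) (simp add: fD' V)
    then show ?thesis
      using leaf_transport[OF ws closed(2) sY(2), of U V1 V2]
      unfolding D ins slide by (simp add: V)
  qed
qed

section \<open>Exchanging parallel chords\<close>

lemma flat_swap_parallel:
  assumes ws: "weight_system \<phi>" and ab: "a \<noteq> b"
  shows "\<phi> (flat (D1 @ (x @ [a, b] @ y) # D2 @ (x' @ [a, b] @ y') # D3))
       = \<phi> (flat (D1 @ (x @ [b, a] @ y) # D2 @ (x' @ [b, a] @ y') # D3))"
proof -
  have *: "flat (D1 @ v # D2 @ w # D3) = concat (map (\<lambda>w. map Some w @ [None]) D1) @ map Some v
     @ concat (map (\<lambda>w. None # map Some w) D2) @ None # map Some w
     @ concat (map (\<lambda>w. None # map Some w) D3)" for v w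
    by (simp add: flat_context)
  show ?thesis
    unfolding *
    using swap_parallel_chords[OF ws ab, of "concat (map (\<lambda>w. map Some w @ [None]) D1) @ map Some x"
      "map Some y @ concat (map (\<lambda>w. None # map Some w) D2) @ None # map Some x'"
      "map Some y' @ concat (map (\<lambda>w. None # map Some w) D3)"]
    by simp
qed

primrec before :: "'a list \<Rightarrow> 'a \<Rightarrow> 'a \<Rightarrow> bool" where
  "before [] p q \<longleftrightarrow> False"
| "before (c # l) p q \<longleftrightarrow> c = p \<and> q \<in> set l \<or> before l p q"

lemma before_in_set: "before l p q \<Longrightarrow> p \<in> set l \<and> q \<in> set l"
  by (induction l) auto

lemma before_append:
  "before (x @ y) p q \<longleftrightarrow> before x p q \<or> before y p q \<or> p \<in> set x \<and> q \<in> set y"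
  by (induction x) auto

lemma before_filter: "before (filter P l) p q \<longleftrightarrow> P p \<and> P q \<and> before l p q"
  by (induction l) auto

lemma before_asym: "distinct l \<Longrightarrow> before l p q \<Longrightarrow> \<not> before l q p"
proof (induction l)
  case (Cons c l)
  then show ?case using before_in_set[of l p q] before_in_set[of l q p] by auto
qed simp

lemma before_total: "p \<in> set l \<Longrightarrow> q \<in> set l \<Longrightarrow> p \<noteq> q \<Longrightarrow> before l p q \<or> before l q p"
  by (induction l) auto

lemma before_trans: "distinct l \<Longrightarrow> before l p q \<Longrightarrow> before l q c \<Longrightarrow> before l p c"
proof (induction l)
  case (Cons d l)
  then show ?case using before_in_set[of l p q] before_in_set[of l q c] by auto
qed simp

lemma before_map: "inj f \<Longrightarrow> before (map f l) (f p) (f q) \<longleftrightarrow> before l p q"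
  by (induction l) (auto simp: inj_eq inj_image_mem_iff)

lemma before_swap:
  assumes "{p, q} \<noteq> {a, b}" 
  shows "before (x @ b # a # y) p q \<longleftrightarrow> before (x @ a # b # y) p q"
  using assms unfolding before_append before.simps list.set by blast

lemma sorted_wrt_before: "sorted_wrt (before l) l" if "distinct l"
  using that
proof (induction l)
  case (Cons c l)
  have "sorted_wrt (before (c # l)) l" if "sorted_wrt (before l) l"
    by (rule sorted_wrt_mono_rel[of l "before l"]) (use that in auto)
  moreover have "sorted_wrt (before l) l" using Cons by simp
  moreover have "\<forall>y\<in>set l. before (c # l) c y" by simp
  ultimately show ?case unfolding sorted_wrt.simps by blast
qed simp

lemma sorted_wrt_asym_unique:
  assumes "sorted_wrt R l" "sorted_wrt R m" "set l = set m" "distinct l" "distinct m"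
    and "\<And>p q. R p q \<Longrightarrow> \<not> R q p"
  shows "l = m"
  using assms(1-5)
proof (induction l arbitrary: m)
  case (Cons c l)
  then obtain d m' where m: "m = d # m'" by (cases m) auto
  have "c = d"
  proof (rule ccontr)
    assume "c \<noteq> d"
    then have "c \<in> set m'" "d \<in> set l" using Cons.prems m by auto
    then have "R c d" "R d c" using Cons.prems m by auto
    then show False using assms(6) by blast
  qed
  moreover have "set l = set m'"
    using Cons.prems(3-5) m \<open>c = d\<close> insert_ident[of c "set l" "set m'"] by simp
  then have "l = m'" using Cons.IH[of m'] Cons.prems m by simp
  ultimately show ?case using m by simp
qed simp

text \<open>
  If all adjacent letters of \<open>l\<close> stood in the order of \<open>m\<close>, then \<open>l\<close> would be sorted by the order of
  \<open>m\<close>, and so equal to \<open>m\<close>.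
\<close>

lemma adjacent_inversion:
  assumes "distinct l" "distinct m" "set l = set m" "l \<noteq> m"
  obtains x a b y where "l = x @ a # b # y" "before m b a"
proof -
  have "\<not> (\<forall>k. Suc k < length l \<longrightarrow> before m (l ! k) (l ! Suc k))"
  proof
    assume *: "\<forall>k. Suc k < length l \<longrightarrow> before m (l ! k) (l ! Suc k)"
    have "transp (before m)" using before_trans[OF assms(2)] by (rule transpI)
    then have "sorted_wrt (before m) l" using * by (simp add: sorted_wrt_iff_nth_Suc_transp)
    then have "l = m"
      using sorted_wrt_before[OF assms(2)] assms(3,1,2) before_asym[OF assms(2)]
      by (rule sorted_wrt_asym_unique)
    then show False using assms(4) by simp
  qed
  then obtain k where k: "Suc k < length l" "\<not> before m (l ! k) (l ! Suc k)" by blast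
  have split: "l = take k l @ l ! k # l ! Suc k # drop (Suc (Suc k)) l"
    using k(1) by (simp add: Cons_nth_drop_Suc)
  have "l ! k \<noteq> l ! Suc k" using nth_eq_iff_index_eq[OF assms(1), of k "Suc k"] k(1) by simp
  then have "before m (l ! Suc k) (l ! k)"
    using before_total[of "l ! k" m "l ! Suc k"] k nth_mem[of k l] nth_mem[of "Suc k" l]
    unfolding assms(3) by simp
  then show ?thesis by (rule that[OF split])
qed

lemma before_split: "before l p q \<Longrightarrow> \<exists>x y z. l = x @ p # y @ q # z"
proof (induction l)
  case (Cons c l)
  then consider "c = p" "q \<in> set l" | "before l p q" by auto
  then show ?case
  proof cases
    case 1
    then obtain y z where "l = y @ q # z" by (meson split_list)
    then have "c # l = [] @ p # y @ q # z" using 1 by simp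
    then show ?thesis by blast
  next
    case 2
    then obtain x y z where "l = x @ p # y @ q # z" using Cons.IH by blast
    then have "c # l = (c # x) @ p # y @ q # z" by simp
    then show ?thesis by blast
  qed
qed simp

text \<open>
  Exchanging two parallel chords that are adjacent at both ends is the same as exchanging their names.
  The second description keeps the bookkeeping of orders in all components uniform.
\<close>

lemma flat_transpose_adjacent:
  assumes ws: "weight_system \<phi>" and ij: "i < j" "j < length E"
    and Ei: "E ! i = x @ a # b # y" "distinct (E ! i)"
    and Ej: "E ! j = x' @ a # b # y'" "distinct (E ! j)"
    and other: "\<And>k. k < length E \<Longrightarrow> k \<noteq> i \<Longrightarrow> k \<noteq> j \<Longrightarrow> a \<notin> set (E ! k) \<and> b \<notin> set (E ! k)"
  shows "\<phi> (flat E) = \<phi> (flat (map (map (transpose a b)) E))"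
proof -
  let ?t = "map (transpose a b)"
  define D1 where "D1 = take i E"
  define D2 where "D2 = take (j - Suc i) (drop (Suc i) E)"
  define D3 where "D3 = drop (Suc j) E"
  have "drop (Suc i) E = D2 @ drop (j - Suc i) (drop (Suc i) E)"
    unfolding D2_def by (rule append_take_drop_id[symmetric])
  also have "drop (j - Suc i) (drop (Suc i) E) = drop j E" using ij by simp
  also have "drop j E = E ! j # D3" unfolding D3_def using ij(2) by (rule Cons_nth_drop_Suc[symmetric])
  finally have d: "drop (Suc i) E = D2 @ E ! j # D3" .
  have "E = take i E @ E ! i # drop (Suc i) E"
    by (rule id_take_nth_drop) (use ij in linarith)
  then have E: "E = D1 @ (x @ [a, b] @ y) # D2 @ (x' @ [a, b] @ y') # D3"
    unfolding d Ei(1) Ej(1) D1_def[symmetric] by simp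
  have ab: "a \<noteq> b" using Ei by auto
  have id: "?t w = w" if "a \<notin> set w" "b \<notin> set w" for w
    using that by (induction w) (auto simp: transpose_def)
  have l: "length D1 = i" "length D2 = j - Suc i" using ij by (simp_all add: D1_def D2_def)
  have mapid: "map ?t L = L" if "\<And>w. w \<in> set L \<Longrightarrow> a \<notin> set w \<and> b \<notin> set w" for L
    using that id by (induction L) auto
  have D1: "map ?t D1 = D1"
  proof (rule mapid)
    fix w assume "w \<in> set D1"
    then obtain k where "k < i" "w = E ! k" using ij by (auto simp: D1_def in_set_conv_nth)
    then show "a \<notin> set w \<and> b \<notin> set w" using other[of k] ij by auto
  qed
  have D2: "map ?t D2 = D2"
  proof (rule mapid)
    fix w assume "w \<in> set D2"
    then obtain k where "k < j - Suc i" "w = E ! (Suc i + k)" using ij by (auto simp: D2_def in_set_conv_nth)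
    then show "a \<notin> set w \<and> b \<notin> set w" using other[of "Suc i + k"] ij by auto
  qed
  have D3: "map ?t D3 = D3"
  proof (rule mapid)
    fix w assume "w \<in> set D3"
    then obtain k where "k < length E - Suc j" "w = E ! (Suc j + k)" using ij by (auto simp: D3_def in_set_conv_nth)
    then show "a \<notin> set w \<and> b \<notin> set w" using other[of "Suc j + k"] ij by auto
  qed
  have xy: "?t x = x" "?t y = y" "?t x' = x'" "?t y' = y'"
    using Ei Ej by (auto intro!: id)
  have t: "map ?t E = D1 @ (x @ [b, a] @ y) # D2 @ (x' @ [b, a] @ y') # D3"
    unfolding E map_append list.map D1 D2 D3 xy by simp
  show ?thesis unfolding t by (subst E) (rule flat_swap_parallel[OF ws ab])
qed

lemma card_2_other:
  assumes "card S = 2" "i \<in> S"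
  obtains j where "S = {i, j}" "j \<noteq> i"
proof -
  obtain p q where "S = {p, q}" "p \<noteq> q" using assms(1) by (auto simp: card_2_iff)
  then show thesis using that[of p] that[of q] assms(2) by auto
qed

text \<open>
  Used for labels with two elements: there are no self chords, and chords with equal labels are parallel.
\<close>

definition skeleton :: "('a \<Rightarrow> nat set) \<Rightarrow> 'a set \<Rightarrow> 'a list list \<Rightarrow> bool" where
  "skeleton lab C E \<longleftrightarrow>
     (\<forall>k<length E. distinct (E ! k) \<and> set (E ! k) = {c \<in> C. k \<in> lab c}) \<and>
     (\<forall>p\<in>C. \<forall>q\<in>C. lab p = lab q \<longrightarrow>
        (\<forall>k\<in>lab p. \<forall>l\<in>lab p. before (E ! k) p q \<longleftrightarrow> before (E ! l) p q))"

text \<open>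
  Bubble sort. As long as the diagrams differ, some component \<open>i\<close> of \<open>E\<close> has adjacent letters \<open>a\<close>, \<open>b\<close>
  in the order opposite to \<open>F\<close>. Their labels are equal, since other orders agree. They are then adjacent
  on their other component \<open>j\<close> too: a chord between them on \<open>j\<close> with the same label would be parallel to
  them and lie between them on \<open>i\<close>, and one with a different label would force the order of \<open>a\<close> and \<open>b\<close>
  in \<open>F\<close>. So they can be exchanged on both components, which removes one inversion.
\<close>

lemma reorder_parallel_chords:
  fixes E F :: "'a list list"
  assumes ws: "weight_system \<phi>" and fin: "finite C"
    and lab: "\<And>c. c \<in> C \<Longrightarrow> lab c \<subseteq> {..<length F} \<and> card (lab c) = 2"
    and F: "skeleton lab C F" 
    and E: "skeleton lab C E" "length E = length F"
    and O1: "\<And>k p q. k < length F \<Longrightarrow> p \<in> C \<Longrightarrow> q \<in> C \<Longrightarrow> k \<in> lab p \<Longrightarrow> k \<in> lab q \<Longrightarrow>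
          lab p \<noteq> lab q \<Longrightarrow> before (E ! k) p q \<longleftrightarrow> before (F ! k) p q"
  shows "\<phi> (flat E) = \<phi> (flat F)"
  using E O1
proof (induction "card {(p, q) \<in> C \<times> C. \<exists>k<length F. before (E ! k) p q \<and> before (F ! k) q p}"
    arbitrary: E rule: less_induct)
  case less
  note E = less.prems(1,2) and O1 = less.prems(3)
  have dE: "distinct (E ! k)" and sE: "set (E ! k) = {c \<in> C. k \<in> lab c}" if "k < length F" for k
    using E that unfolding skeleton_def by auto
  have dF: "distinct (F ! k)" and sF: "set (F ! k) = {c \<in> C. k \<in> lab c}" if "k < length F" for k
    using F that unfolding skeleton_def by auto
  have O2E: "before (E ! k) p q \<Longrightarrow> before (E ! l) p q"
    if "p \<in> C" "q \<in> C" "lab p = lab q" "k \<in> lab p" "l \<in> lab p" for p q k l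
    using E(1) that unfolding skeleton_def by blast
  have O2F: "before (F ! k) p q \<Longrightarrow> before (F ! l) p q"
    if "p \<in> C" "q \<in> C" "lab p = lab q" "k \<in> lab p" "l \<in> lab p" for p q k l
    using F that unfolding skeleton_def by blast
  show ?case
  proof (cases "E = F")
    case False
    then obtain i where i: "i < length F" "E ! i \<noteq> F ! i"
      using E(2) nth_equalityI[of E F] by auto
    obtain x a b y where Ei: "E ! i = x @ a # b # y" and ba: "before (F ! i) b a"
    proof (rule adjacent_inversion[OF dE[OF i(1)] dF[OF i(1)] _ i(2)])
      show "set (E ! i) = set (F ! i)" using sE[OF i(1)] sF[OF i(1)] by simp
    qed
    have abE: "before (E ! i) a b" unfolding Ei before_append by simp
    have abi: "a \<in> C" "b \<in> C" "i \<in> lab a" "i \<in> lab b"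
      using before_in_set[OF abE] sE[OF i(1)] by auto
    have ab: "a \<noteq> b" using dE[OF i(1)] Ei by auto
    have nabF: "\<not> before (F ! i) a b" by (rule before_asym[OF dF[OF i(1)] ba])
    have lab_eq: "lab a = lab b"
      using O1[OF i(1) abi] abE nabF by blast
    obtain j where j: "lab a = {i, j}" "j \<noteq> i"
      using card_2_other[of "lab a" i] lab[OF abi(1)] abi(3) by auto
    have jn: "j < length F" using lab[OF abi(1)] j by auto
    have abEj: "before (E ! j) a b" using O2E[OF abi(1,2) lab_eq _ _ abE] j by simp
    have nabFj: "\<not> before (F ! j) a b"
      using O2F[OF abi(1,2) lab_eq, of j i] nabF j by auto
    obtain x' z y' where Ej': "E ! j = x' @ a # z @ b # y'" using before_split[OF abEj] by blast
    \<comment> \<open>\<open>a\<close> and \<open>b\<close> are adjacent on component \<open>j\<close> as well\<close>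
    have "z = []"
    proof (rule ccontr)
      assume "z \<noteq> []"
      then obtain c where c: "c \<in> set z" by (cases z) auto
      have ac: "before (E ! j) a c" and cb: "before (E ! j) c b"
        using c by (auto simp: Ej' before_append)
      have cC: "c \<in> C" "j \<in> lab c" using before_in_set[OF ac] sE[OF jn] by auto
      show False
      proof (cases "lab c = lab a")
        case True
        have ac': "before (E ! i) a c" using O2E[OF abi(1) cC(1) True[symmetric] _ _ ac] j by simp
        have cb': "before (E ! i) c b" using O2E[of c b j i] cC abi cb True lab_eq by simp
        have "c \<noteq> a" "c \<noteq> b" using c dE[OF jn] Ej' by auto
        then have "c \<in> set y"
          using ac' dE[OF i(1)] by (auto simp: Ei before_append dest: before_in_set)
        then have "before (E ! i) b c" by (simp add: Ei before_append)
        then show False using cb' before_asym[OF dE[OF i(1)]] by blast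
      next
        case False
        have "before (F ! j) a c" using O1[OF jn abi(1) cC(1) _ cC(2)] False ac j by auto
        moreover have "before (F ! j) c b" using O1[OF jn cC(1) abi(2) cC(2)] False cb j lab_eq by auto
        ultimately show False using before_trans[OF dF[OF jn]] nabFj by blast
      qed
    qed
    then have Ej: "E ! j = x' @ a # b # y'" using Ej' by simp
    let ?t = "transpose a b"
    define E' where "E' = map (map ?t) E"
    have len: "length E' = length F" by (simp add: E'_def E(2))
    have other: "a \<notin> set (E ! k) \<and> b \<notin> set (E ! k)" if "k < length F" "k \<noteq> i" "k \<noteq> j" for k
      using sE[OF that(1)] that j lab_eq by auto
    have phi: "\<phi> (flat E) = \<phi> (flat E')"
    proof (cases "i < j")
      case True
      show ?thesis unfolding E'_def
        by (rule flat_transpose_adjacent[OF ws True _ Ei dE Ej dE])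
          (use E(2) i(1) jn other in auto)
    next
      case False
      then have "j < i" using j by simp
      show ?thesis unfolding E'_def
        by (rule flat_transpose_adjacent[OF ws \<open>j < i\<close> _ Ej dE Ei dE])
          (use E(2) i(1) jn other in auto)
    qed
    have nthE': "E' ! k = map ?t (E ! k)" if "k < length F" for k
      using that E(2) by (simp add: E'_def)
    have bE': "before (E' ! k) p q \<longleftrightarrow> before (E ! k) (?t p) (?t q)" if "k < length F" for k p q
      using before_map[of ?t "E ! k" "?t p" "?t q"] nthE'[OF that]
      by (simp add: bij_is_inj bij_transpose)
    have id: "map ?t w = w" if "a \<notin> set w" "b \<notin> set w" for w
      using that by (induction w) (auto simp: transpose_def)
    have bE'2: "before (E' ! k) p q \<longleftrightarrow> before (E ! k) p q" if "k < length F" "{p, q} \<noteq> {a, b}" for k p q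
    proof -
      consider "k = i" | "k = j" | "k \<noteq> i" "k \<noteq> j" by blast
      then show ?thesis
      proof cases
        case 1
        have "a \<notin> set x" "b \<notin> set x" "a \<notin> set y" "b \<notin> set y" using dE[OF i(1)] Ei by auto
        then have "E' ! k = x @ b # a # y" using nthE'[OF that(1)] by (simp add: 1 Ei id)
        then show ?thesis unfolding 1 Ei using before_swap[OF that(2)] by simp
      next
        case 2
        have "a \<notin> set x'" "b \<notin> set x'" "a \<notin> set y'" "b \<notin> set y'" using dE[OF jn] Ej by auto
        then have "E' ! k = x' @ b # a # y'" using nthE'[OF that(1)] by (simp add: 2 Ej id)
        then show ?thesis unfolding 2 Ej using before_swap[OF that(2)] by simp
      next
        case 3
        then show ?thesis using other[OF that(1)] nthE'[OF that(1)] id by simp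
      qed
    qed
    have skel: "skeleton lab C E'"
      unfolding skeleton_def len
    proof (intro conjI allI impI ballI)
      fix k assume k: "k < length F"
      show "distinct (E' ! k)"
        unfolding nthE'[OF k] distinct_map using dE[OF k] bij_transpose[of a b]
        by (auto intro: inj_on_subset bij_is_inj)
      show "set (E' ! k) = {c \<in> C. k \<in> lab c}"
      proof -
        have "lab (?t c) = lab c" "?t c \<in> C \<longleftrightarrow> c \<in> C" for c
          using lab_eq abi by (auto simp: transpose_def)
        then have "?t ` {c \<in> C. k \<in> lab c} = {c \<in> C. k \<in> lab c}"
          by (auto intro!: image_eqI[of _ ?t "?t _"])
        then show ?thesis unfolding nthE'[OF k] using sE[OF k] by simp
      qed
    next
      fix p q k l assume pq: "p \<in> C" "q \<in> C" "lab p = lab q" "k \<in> lab p" "l \<in> lab p"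
      have kl: "k < length F" "l < length F" using lab[OF pq(1)] pq by auto
      have t: "lab (?t c) = lab c" "?t c \<in> C \<longleftrightarrow> c \<in> C" for c
        using lab_eq abi by (auto simp: transpose_def)
      show "before (E' ! k) p q \<longleftrightarrow> before (E' ! l) p q"
        unfolding bE'[OF kl(1)] bE'[OF kl(2)]
        using O2E[of "?t p" "?t q" k l] O2E[of "?t p" "?t q" l k] pq t by auto
    qed
    have O1': "before (E' ! k) p q \<longleftrightarrow> before (F ! k) p q"
      if "k < length F" "p \<in> C" "q \<in> C" "k \<in> lab p" "k \<in> lab q" "lab p \<noteq> lab q" for k p q
    proof -
      have "{p, q} \<noteq> {a, b}" using that(6) lab_eq by (auto simp: doubleton_eq_iff)
      then show ?thesis using bE'2[OF that(1)] O1[OF that] by simp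
    qed
    let ?inv = "\<lambda>E. {(p, q) \<in> C \<times> C. \<exists>k<length F. before (E ! k) p q \<and> before (F ! k) q p}"
    have sub: "?inv E' \<subseteq> ?inv E - {(a, b)}"
    proof (intro subsetI)
      fix pq assume "pq \<in> ?inv E'"
      then obtain p q k where pq: "pq = (p, q)" "p \<in> C" "q \<in> C" "k < length F"
        "before (E' ! k) p q" "before (F ! k) q p" by auto
      have k: "k \<in> lab p" "k \<in> lab q" using before_in_set[OF pq(6)] sF[OF pq(4)] by auto
      \<comment> \<open>the pair \<open>(a, b)\<close> is no inversion any more, and \<open>(b, a)\<close> has not become one\<close>
      have n1: "\<not> (p = a \<and> q = b)"
      proof
        assume *: "p = a \<and> q = b"
        then have "before (E ! k) b a" using pq bE'[OF pq(4)] by simp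
        moreover have "before (E ! k) a b" using O2E[OF abi(1,2) lab_eq abi(3) _ abE] * k by simp
        ultimately show False using before_asym[OF dE[OF pq(4)]] by blast
      qed
      have n2: "\<not> (p = b \<and> q = a)"
      proof
        assume *: "p = b \<and> q = a"
        have "before (F ! k) b a" using O2F[OF abi(2,1) lab_eq[symmetric] abi(4) _ ba] * k by simp
        then show False using before_asym[OF dF[OF pq(4)]] pq(6) * by blast
      qed
      have "{p, q} \<noteq> {a, b}" using n1 n2 by (auto simp: doubleton_eq_iff)
      then have "before (E ! k) p q" using bE'2[OF pq(4)] pq(5) by simp
      then show "pq \<in> ?inv E - {(a, b)}" using pq n1 by auto
    qed
    moreover have "(a, b) \<in> ?inv E" using abi abE ba i(1) by auto
    ultimately have "?inv E' \<subset> ?inv E" by blast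
    moreover have "finite (?inv E)"
      by (rule finite_subset[of _ "C \<times> C"]) (use fin in auto)
    ultimately have "card (?inv E') < card (?inv E)" by (rule psubset_card_mono[rotated])
    then have "\<phi> (flat E') = \<phi> (flat F)"
      using skel len O1' by (rule less.hyps)
    then show ?thesis using phi by simp
  qed simp
qed

section \<open>Labels and edges read off from the words\<close>

abbreviation label :: "word_system \<Rightarrow> nat \<Rightarrow> nat set" where
  "label D v \<equiv> fst ` endpoints D v"

lemma label_eq: "label D v = {k. k < length D \<and> v \<in> set (D ! k)}"
  by (fastforce simp: endpoints_def in_set_conv_nth image_iff)

lemma count_list_concat: "count_list (concat D) v = (\<Sum>k<length D. count_list (D ! k) v)"
proof (induction D rule: rev_induct)
  case (snoc w D)
  have "(\<Sum>k<length D. count_list ((D @ [w]) ! k) v) = (\<Sum>k<length D. count_list (D ! k) v)"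
    by (intro sum.cong) (auto simp: nth_append)
  then show ?case using snoc by simp
qed simp

lemma sum_count_label:
  assumes "is_chord_diagram n D" "v \<in> chords D"
  shows "(\<Sum>k\<in>label D v. count_list (D ! k) v) = 2"
proof -
  have "2 = (\<Sum>k<length D. count_list (D ! k) v)"
    using assms unfolding is_chord_diagram_def chords_def count_list_concat[symmetric] by metis
  also have "\<dots> = (\<Sum>k\<in>label D v. count_list (D ! k) v)"
    by (rule sum.mono_neutral_right) (auto simp: label_eq count_list_0_iff)
  finally show ?thesis by simp
qed

lemma label_count_pos: "k \<in> label D v \<Longrightarrow> count_list (D ! k) v \<ge> 1"
  using count_list_0_iff[of "D ! k" v] by (cases "count_list (D ! k) v") (auto simp: label_eq)

lemma finite_label: "finite (label D v)"
  unfolding label_eq by simp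

lemma card_label_le:
  assumes "is_chord_diagram n D" "v \<in> chords D"
  shows "card (label D v) \<le> 2"
proof -
  have "card (label D v) = (\<Sum>k\<in>label D v. 1)" by simp
  also have "\<dots> \<le> (\<Sum>k\<in>label D v. count_list (D ! k) v)"
    by (intro sum_mono label_count_pos)
  finally show ?thesis using sum_count_label[OF assms] by simp
qed

lemma label_nonempty: "is_chord_diagram n D \<Longrightarrow> v \<in> chords D \<Longrightarrow> label D v \<noteq> {}"
  using sum_count_label by fastforce

text \<open>
  The second case is a self chord: its two ends lie on the single component \<open>i\<close>.
\<close>

lemma label_cases:
  assumes "is_chord_diagram n D" "v \<in> chords D"
  obtains "card (label D v) = 2" | i where "label D v = {i}"
proof -
  have "card (label D v) \<noteq> 0" using label_nonempty[OF assms] finite_label by simp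
  then consider "card (label D v) = 2" | "card (label D v) = 1"
    using card_label_le[OF assms] by linarith
  then show thesis
    by (cases) (use that card_1_singletonE in blast)+
qed

lemma count_cross_chord:
  assumes "is_chord_diagram n D" "v \<in> chords D" "card (label D v) = 2" "k < length D"
  shows "count_list (D ! k) v \<le> 1"
proof (cases "k \<in> label D v")
  case True
  obtain l where l: "label D v = {k, l}" "l \<noteq> k"
    using card_2_other[OF assms(3) True] by blast
  have "count_list (D ! k) v + count_list (D ! l) v = 2"
    using sum_count_label[OF assms(1,2)] l by simp
  moreover have "count_list (D ! l) v \<ge> 1" using label_count_pos[of l D v] l by simp
  ultimately show ?thesis by simp
next
  case False
  then have "v \<notin> set (D ! k)" using assms(4) unfolding label_eq by simp
  then show ?thesis using count_list_0_iff[of "D ! k" v] by simp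
qed

lemma count_self_chord:
  assumes "is_chord_diagram n D" "v \<in> chords D" "label D v = {i}"
  shows "count_list (D ! i) v = 2"
  using sum_count_label[OF assms(1,2)] assms(3) by simp

lemma before_nth: "before l p q \<longleftrightarrow> (\<exists>i j. i < j \<and> j < length l \<and> l ! i = p \<and> l ! j = q)"
proof
  assume "before l p q"
  then obtain x y z where "l = x @ p # y @ q # z" using before_split by metis
  then show "\<exists>i j. i < j \<and> j < length l \<and> l ! i = p \<and> l ! j = q"
    by (intro exI[of _ "length x"] exI[of _ "length x + length y + 1"]) (auto simp: nth_append)
next
  assume "\<exists>i j. i < j \<and> j < length l \<and> l ! i = p \<and> l ! j = q"
  then obtain i j where ij: "i < j" "j < length l" "l ! i = p" "l ! j = q" by blast
  have l: "take (Suc i) l @ drop (Suc i) l = l" by simp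
  have "p \<in> set (take (Suc i) l)" using ij by (auto simp: in_set_conv_nth intro!: exI[of _ i])
  moreover have "q \<in> set (drop (Suc i) l)"
    using ij by (auto simp: in_set_conv_nth intro!: exI[of _ "j - Suc i"])
  ultimately show "before l p q" using before_append[of "take (Suc i) l" "drop (Suc i) l" p q] l by simp
qed

lemma positions_unique:
  assumes "count_list l v \<le> 1" "p < length l" "q < length l" "l ! p = v" "l ! q = v"
  shows "p = q"
proof (rule ccontr)
  assume "p \<noteq> q"
  have "{k \<in> {0..<length l}. l ! k = v} \<supseteq> {p, q}" using assms by auto
  then have "card {p, q} \<le> card {k \<in> {0..<length l}. l ! k = v}" by (intro card_mono) auto
  moreover have "card {k \<in> {0..<length l}. l ! k = v} = count_list l v"
    using card_positions[of "[]" l "[]" v] by simp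
  ultimately show False using \<open>p \<noteq> q\<close> assms(1) by simp
qed

text \<open>
  Both chords meet every component at most once, so each component contributes at most one edge.
\<close>

lemma multiplicity_cross_chords:
  assumes "\<And>k. k < length D \<Longrightarrow> count_list (D ! k) v \<le> 1"
    and "\<And>k. k < length D \<Longrightarrow> count_list (D ! k) w \<le> 1"
  shows "multiplicity_edge D v w = card {k. k < length D \<and> before (D ! k) v w}"
proof -
  let ?S = "{(e1, e2). e1 \<in> endpoints D v \<and> e2 \<in> endpoints D w \<and> below e1 e2}"
  have S: "?S = {((k, p), (k, q)) | k p q.
      k < length D \<and> p < q \<and> q < length (D ! k) \<and> D ! k ! p = v \<and> D ! k ! q = w}" (is "_ = ?T")
    by (auto simp: endpoints_def below_def)
  have "inj_on (\<lambda>e. fst (fst e)) ?T"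
  proof (rule inj_onI)
    fix e e' assume "e \<in> ?T" "e' \<in> ?T" and eq: "fst (fst e) = fst (fst e')"
    then obtain k p q k' p' q' where e: "e = ((k, p), (k, q))" "k < length D" "p < q" "q < length (D ! k)"
        "D ! k ! p = v" "D ! k ! q = w"
      and e': "e' = ((k', p'), (k', q'))" "p' < q'" "q' < length (D ! k')" "D ! k' ! p' = v" "D ! k' ! q' = w"
      by blast
    have k: "k' = k" using eq e(1) e'(1) by simp
    have "p = p'"
      by (rule positions_unique[OF assms(1)[OF e(2)]]) (use e e' k in simp_all)
    moreover have "q = q'"
      by (rule positions_unique[OF assms(2)[OF e(2)]]) (use e e' k in simp_all)
    ultimately show "e = e'" using e(1) e'(1) k by simp
  qed
  moreover have "(\<lambda>e. fst (fst e)) ` ?T = {k. k < length D \<and> before (D ! k) v w}"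
  proof (intro equalityI subsetI)
    fix k assume "k \<in> (\<lambda>e. fst (fst e)) ` ?T"
    then show "k \<in> {k. k < length D \<and> before (D ! k) v w}"
      unfolding before_nth by fastforce
  next
    fix k assume "k \<in> {k. k < length D \<and> before (D ! k) v w}"
    then obtain p q where "k < length D" "p < q" "q < length (D ! k)" "D ! k ! p = v" "D ! k ! q = w"
      unfolding before_nth by blast
    then have "((k, p), (k, q)) \<in> ?T" by blast
    then show "k \<in> (\<lambda>e. fst (fst e)) ` ?T" by (rule rev_image_eqI) simp
  qed
  ultimately have "card ?T = card {k. k < length D \<and> before (D ! k) v w}"
    using card_image[of "\<lambda>e. fst (fst e)" ?T] by simp
  then show ?thesis unfolding multiplicity_edge_def S .
qed

text \<open>
  An end of \<open>c\<close> in the arc \<open>y\<close> between the ends of \<open>s\<close> is counted once, one outside that arc is counted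
  an even number of times. Hence adjacency to \<open>s\<close> is the parity of the number of ends of \<open>c\<close> in \<open>y\<close>, and
  the edge is always undirected.
\<close>

lemma multiplicity_self_chord:
  assumes i: "i < length D" and Di: "D ! i = x @ [s] @ y @ [s] @ t"
    and s: "s \<notin> set x" "s \<notin> set y" "s \<notin> set t"
    and other: "\<And>k. k < length D \<Longrightarrow> k \<noteq> i \<Longrightarrow> s \<notin> set (D ! k)" and c: "c \<noteq> s"
  shows "multiplicity_edge D s c = count_list y c + 2 * count_list t c"
    and "multiplicity_edge D c s = count_list y c + 2 * count_list x c"
proof -
  define p1 where "p1 = length x"
  define p2 where "p2 = length x + length y + 1"
  have ends: "endpoints D s = {(i, p1), (i, p2)}"
  proof (intro equalityI subsetI)
    fix e assume "e \<in> endpoints D s"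
    then obtain k p where e: "e = (k, p)" "k < length D" "p < length (D ! k)" "D ! k ! p = s"
      unfolding endpoints_def by auto
    then have k: "k = i" using other[of k] nth_mem by metis
    have "p < length (x @ [s] @ y @ [s] @ t)" "(x @ [s] @ y @ [s] @ t) ! p = s"
      using e k Di by auto
    then have "p = p1 \<or> p = p2"
      using s nth_mem[of p x] nth_mem[of "p - length x - 1" y] nth_mem[of "p - length x - length y - 2" t]
      unfolding p1_def p2_def
      by (auto simp: nth_append nth_Cons' split: if_splits)
    then show "e \<in> {(i, p1), (i, p2)}" using e k by auto
  next
    fix e assume "e \<in> {(i, p1), (i, p2)}"
    then show "e \<in> endpoints D s" unfolding endpoints_def p1_def p2_def
      using i by (auto simp: Di nth_append)
  qed
  define Q where "Q = (\<lambda>P. {q. q < length (D ! i) \<and> D ! i ! q = c \<and> P q})"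
  have fin: "finite (Q P)" for P unfolding Q_def by simp
  have len: "length (D ! i) = length x + length y + length t + 2" using Di by simp
  have seg: "card {k \<in> {length u..<length u + length B}. D ! i ! k = c} = count_list B c"
    if "D ! i = u @ B @ w" for u B w
    using card_positions[of u B w c] that by simp
  have above1: "card (Q (\<lambda>q. p1 < q)) = count_list y c + count_list t c"
  proof -
    have "Q (\<lambda>q. p1 < q) = {k \<in> {length (x @ [s])..<length (x @ [s]) + length (y @ [s] @ t)}. D ! i ! k = c}"
      unfolding Q_def p1_def using len by auto
    then show ?thesis using seg[of "x @ [s]" "y @ [s] @ t" "[]"] Di c by simp
  qed
  have above2: "card (Q (\<lambda>q. p2 < q)) = count_list t c"
  proof -
    have "Q (\<lambda>q. p2 < q) = {k \<in> {length (x @ [s] @ y @ [s])..<length (x @ [s] @ y @ [s]) + length t}. D ! i ! k = c}"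
      unfolding Q_def p2_def using len by auto
    then show ?thesis using seg[of "x @ [s] @ y @ [s]" t "[]"] Di c by simp
  qed
  have below1: "card (Q (\<lambda>q. q < p1)) = count_list x c"
  proof -
    have "Q (\<lambda>q. q < p1) = {k \<in> {length ([] :: nat list)..<length ([] :: nat list) + length x}. D ! i ! k = c}"
      unfolding Q_def p1_def using len by auto
    then show ?thesis using seg[of "[]" x "[s] @ y @ [s] @ t"] Di c by simp
  qed
  have below2: "card (Q (\<lambda>q. q < p2)) = count_list x c + count_list y c"
  proof -
    have "Q (\<lambda>q. q < p2) = {k \<in> {length ([] :: nat list)..<length ([] :: nat list) + length (x @ [s] @ y)}. D ! i ! k = c}"
      unfolding Q_def p2_def using len by auto
    then show ?thesis using seg[of "[]" "x @ [s] @ y" "[s] @ t"] Di c by simp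
  qed
  have pne: "p1 \<noteq> p2" by (simp add: p1_def p2_def)
  have "{(e1, e2). e1 \<in> endpoints D s \<and> e2 \<in> endpoints D c \<and> below e1 e2}
      = (\<lambda>q. ((i, p1), (i, q))) ` Q (\<lambda>q. p1 < q) \<union> (\<lambda>q. ((i, p2), (i, q))) ` Q (\<lambda>q. p2 < q)"
    unfolding ends using i by (auto simp: endpoints_def below_def Q_def image_iff)
  also have "card \<dots> = card (Q (\<lambda>q. p1 < q)) + card (Q (\<lambda>q. p2 < q))"
    by (subst card_Un_disjoint) (auto simp: fin card_image inj_on_def pne)
  finally show "multiplicity_edge D s c = count_list y c + 2 * count_list t c"
    unfolding multiplicity_edge_def above1 above2 by simp
  have "{(e1, e2). e1 \<in> endpoints D c \<and> e2 \<in> endpoints D s \<and> below e1 e2}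
      = (\<lambda>q. ((i, q), (i, p1))) ` Q (\<lambda>q. q < p1) \<union> (\<lambda>q. ((i, q), (i, p2))) ` Q (\<lambda>q. q < p2)"
    unfolding ends using i by (auto simp: endpoints_def below_def Q_def image_iff)
  also have "card \<dots> = card (Q (\<lambda>q. q < p1)) + card (Q (\<lambda>q. q < p2))"
    by (subst card_Un_disjoint) (auto simp: fin card_image inj_on_def pne)
  finally show "multiplicity_edge D c s = count_list y c + 2 * count_list x c"
    unfolding multiplicity_edge_def below1 below2 by simp
qed

definition linked_chords :: "word_system \<Rightarrow> nat \<Rightarrow> nat \<Rightarrow> bool" where
  "linked_chords D v w \<longleftrightarrow> reduced_edge D v w \<or> reduced_edge D w v"

definition cross_chords :: "word_system \<Rightarrow> nat set" where
  "cross_chords D = {c \<in> chords D. card (label D c) = 2}"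

lemma reduced_edge_cross:
  assumes "is_chord_diagram n D" "v \<in> cross_chords D" "w \<in> cross_chords D" "v \<noteq> w"
  shows "reduced_edge D v w \<longleftrightarrow> odd (card {k \<in> label D v \<inter> label D w. before (D ! k) v w})"
proof -
  have "multiplicity_edge D v w = card {k. k < length D \<and> before (D ! k) v w}"
    by (rule multiplicity_cross_chords)
      (use assms(2,3) count_cross_chord[OF assms(1)] in \<open>auto simp: cross_chords_def\<close>)
  also have "{k. k < length D \<and> before (D ! k) v w} = {k \<in> label D v \<inter> label D w. before (D ! k) v w}"
    using before_in_set[of _ v w] by (auto simp: label_eq)
  finally show ?thesis
    using assms unfolding reduced_edge_def cross_chords_def by simp
qed

text \<open>
  Chords with two different labels share at most one component, so no edges cancel.
\<close>

lemma reduced_edge_different_label: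
  assumes "is_chord_diagram n D" "v \<in> cross_chords D" "w \<in> cross_chords D"
    and "label D v \<noteq> label D w" "k \<in> label D v" "k \<in> label D w"
  shows "reduced_edge D v w \<longleftrightarrow> before (D ! k) v w"
proof -
  obtain i where i: "label D v = {k, i}" "i \<noteq> k"
    using card_2_other[of "label D v" k] assms(2,5) unfolding cross_chords_def by auto
  obtain j where j: "label D w = {k, j}" "j \<noteq> k"
    using card_2_other[of "label D w" k] assms(3,6) unfolding cross_chords_def by auto
  have "{l \<in> label D v \<inter> label D w. before (D ! l) v w} = (if before (D ! k) v w then {k} else {})"
    using i j assms(4) by auto
  moreover have "v \<noteq> w" using assms(4) by auto
  ultimately show ?thesis using reduced_edge_cross[OF assms(1-3)] by simp
qed

lemma linked_different_label:
  assumes "is_chord_diagram n D" "v \<in> cross_chords D" "w \<in> cross_chords D"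
    and "label D v \<noteq> label D w" "label D v \<inter> label D w \<noteq> {}"
  shows "linked_chords D v w"
proof -
  obtain k where k: "k \<in> label D v" "k \<in> label D w" using assms(5) by blast
  have "v \<in> set (D ! k)" "w \<in> set (D ! k)" "v \<noteq> w" using k assms(4) unfolding label_eq by auto
  then show ?thesis
    using before_total[of v "D ! k" w] reduced_edge_different_label[OF assms(1-4) k]
      reduced_edge_different_label[OF assms(1,3,2) assms(4)[symmetric] k(2,1)]
    unfolding linked_chords_def by blast
qed

text \<open>
  The two components contribute one edge each exactly if the chords have the same order on both.
\<close>

lemma parallel_if_not_linked:
  assumes "is_chord_diagram n D" "v \<in> cross_chords D" "w \<in> cross_chords D"
    and "label D v = label D w" "\<not> reduced_edge D v w" "k \<in> label D v" "l \<in> label D v"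
  shows "before (D ! k) v w \<longleftrightarrow> before (D ! l) v w"
proof (cases "v = w \<or> k = l")
  case True
  have "\<not> before (D ! i) v v" if "i \<in> label D v" for i
  proof
    assume "before (D ! i) v v"
    moreover have "count_list (D ! i) v \<le> 1"
      using count_cross_chord[OF assms(1)] assms(2) that unfolding cross_chords_def label_eq by auto
    ultimately show False
      unfolding before_nth using positions_unique[of "D ! i" v]
      by (metis less_irrefl less_trans)
  qed
  then show ?thesis using True assms(6,7) by blast
next
  case False
  obtain j where j: "label D v = {k, j}" "j \<noteq> k"
    using card_2_other[of "label D v" k] assms(2,6) unfolding cross_chords_def by auto
  then have jl: "j = l" using assms(7) False by auto
  have "{i \<in> label D v \<inter> label D w. before (D ! i) v w}
      = (if before (D ! k) v w then {k} else {}) \<union> (if before (D ! l) v w then {l} else {})"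
    using j jl assms(4) by auto
  moreover have "even (card {i \<in> label D v \<inter> label D w. before (D ! i) v w})"
    using reduced_edge_cross[OF assms(1-3)] False assms(5) by blast
  ultimately show ?thesis using j jl by (auto split: if_splits)
qed

lemma self_chord_split:
  assumes "is_chord_diagram n D" "s \<in> chords D" "label D s = {i}"
  obtains x y t where "D ! i = x @ [s] @ y @ [s] @ t" "s \<notin> set x" "s \<notin> set y" "s \<notin> set t"
proof -
  have c: "count_list (D ! i) s = 2" by (rule count_self_chord[OF assms])
  have "s \<in> set (D ! i)" using assms(3) unfolding label_eq by auto
  then obtain x z where z: "D ! i = x @ s # z" "s \<notin> set x" by (meson split_list_first)
  have "count_list z s = 1" using c z count_list_0_iff[of x s] by simp
  then have "s \<in> set z" using count_list_0_iff[of z s] by simp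
  then obtain y t where t: "z = y @ s # t" "s \<notin> set y" by (meson split_list_first)
  have "count_list t s = 0" using \<open>count_list z s = 1\<close> t by simp
  then have "s \<notin> set t" unfolding count_list_0_iff .
  then show thesis using that[of x y t] z t by simp
qed

definition restrict_chords :: "nat set \<Rightarrow> word_system \<Rightarrow> word_system" where
  "restrict_chords S D = map (filter (\<lambda>c. c \<in> S)) D"

lemma count_list_filter: "count_list (filter P l) c = (if P c then count_list l c else 0)"
  by (induction l) auto

lemma concat_restrict: "concat (restrict_chords S D) = filter (\<lambda>c. c \<in> S) (concat D)"
  unfolding restrict_chords_def by (simp add: filter_concat)

text \<open>
  Uniqueness of the neighbour \<open>r\<close> fixes the number of ends between the two ends of \<open>s\<close>: odd for \<open>r\<close>, so
  one, and even for every other chord, so none or both. These are the assumptions of \<open>attach_leaf_flat\<close>.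
\<close>

lemma flat_insert_self_chord:
  assumes ws: "weight_system \<phi>" and D: "is_chord_diagram n D"
    and s: "s \<in> chords D" "label D s = {i}" "s \<notin> S" and S: "S \<subseteq> chords D"
    and r: "r \<in> S" "linked_chords D s r" and unique: "\<And>c. c \<in> S \<Longrightarrow> linked_chords D s c \<Longrightarrow> c = r"
  shows "\<phi> (flat (restrict_chords (insert s S) D)) = attach_leaf \<phi> s r i (flat (restrict_chords S D))"
proof -
  obtain x y t where Di: "D ! i = x @ [s] @ y @ [s] @ t" and ns: "s \<notin> set x" "s \<notin> set y" "s \<notin> set t"
    by (rule self_chord_split[OF D s(1,2)])
  have i: "i < length D" using s(2) unfolding label_eq by auto
  have other: "s \<notin> set (D ! k)" if "k < length D" "k \<noteq> i" for k
    using s(2) that unfolding label_eq by auto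
  have cnt: "count_list (concat D) c = 2" if "c \<in> S" for c
    using D S that unfolding is_chord_diagram_def chords_def by blast
  have rs: "s \<noteq> r" using r s(3) by auto
  have linked: "linked_chords D s c \<longleftrightarrow> odd (count_list y c)" if "c \<in> S" for c
  proof -
    have "c \<noteq> s" using that s(3) by auto
    then show ?thesis
      using multiplicity_self_chord[OF i Di ns other, of c] s(1) S that
      unfolding linked_chords_def reduced_edge_def by auto
  qed
  let ?f = "filter (\<lambda>c. c \<in> S)" and ?g = "filter (\<lambda>c. c \<in> insert s S)"
  define D1 where "D1 = take i D"
  define D2 where "D2 = drop (Suc i) D"
  have Dsplit: "D = D1 @ (x @ [s] @ y @ [s] @ t) # D2"
    unfolding D1_def D2_def Di[symmetric] by (rule id_take_nth_drop[OF i])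
  have fg: "?g w = ?f w" if "s \<notin> set w" for w
    using that by (intro filter_cong) auto
  have D1: "map ?g D1 = map ?f D1"
  proof (rule map_cong[OF refl])
    fix w assume "w \<in> set D1"
    then obtain k where "k < i" "w = D ! k" using i by (auto simp: D1_def in_set_conv_nth)
    then show "?g w = ?f w" using other[of k] i by (intro fg) auto
  qed
  have D2: "map ?g D2 = map ?f D2"
  proof (rule map_cong[OF refl])
    fix w assume "w \<in> set D2"
    then obtain k where "k < length D - Suc i" "w = D ! (Suc i + k)"
      using i by (auto simp: D2_def in_set_conv_nth)
    then show "?g w = ?f w" using other[of "Suc i + k"] i by (intro fg) auto
  qed
  have sw: "?g [s] = [s]" "?f [s] = []" using s(3) by simp_all
  have big: "restrict_chords (insert s S) D = map ?f D1 @ (?f x @ [s] @ ?f y @ [s] @ ?f t) # map ?f D2"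
    unfolding restrict_chords_def
    by (subst Dsplit) (simp only: map_append list.map filter_append D1 D2 sw fg[OF ns(1)] fg[OF ns(2)] fg[OF ns(3)])
  have small: "restrict_chords S D = map ?f D1 @ (?f x @ ?f y @ ?f t) # map ?f D2"
    unfolding restrict_chords_def
    by (subst Dsplit) (simp only: map_append list.map filter_append sw append_Nil)
  have le2: "count_list y c \<le> 2" if "c \<in> S" for c
  proof -
    have "count_list y c \<le> count_list (concat D) c" by (subst Dsplit) simp
    then show ?thesis using cnt[OF that] by simp
  qed
  have "\<phi> (flat (map ?f D1 @ (?f x @ [s] @ ?f y @ [s] @ ?f t) # map ?f D2))
      = attach_leaf \<phi> s r (length (map ?f D1)) (flat (restrict_chords S D))"
  proof (rule attach_leaf_flat[OF ws rs small])
    show "s \<notin> set (concat (restrict_chords S D))" using s(3) unfolding concat_restrict by simp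
    show "count_list (concat (restrict_chords S D)) r = 2"
      using cnt[OF r(1)] r(1) unfolding concat_restrict count_list_filter by simp
    have "odd (count_list y r)" using linked[OF r(1)] r(2) by simp
    then show "count_list (?f y) r = 1"
      using le2[OF r(1)] r(1) unfolding count_list_filter by (auto elim!: oddE)
    fix c assume c: "c \<in> set (?f y)" "c \<noteq> r"
    then have "c \<in> S" "c \<in> set y" by auto
    moreover have "even (count_list y c)" using unique[of c] linked[of c] c \<open>c \<in> S\<close> by blast
    moreover have "count_list y c \<noteq> 0" using \<open>c \<in> set y\<close> unfolding count_list_0_iff by simp
    ultimately show "count_list (?f y) c = 2"
      using le2[of c] unfolding count_list_filter by (auto elim!: evenE)
  qed
  then show ?thesis unfolding big using i by (simp add: D1_def)
qed

section \<open>Growth of trees\<close>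

text \<open>
  Connectedness by paths without repetition, so that two paths closing up give a cycle in the sense of
  \<open>is_cycle\<close> at once.
\<close>

definition path_connected_in :: "('a \<Rightarrow> 'a \<Rightarrow> bool) \<Rightarrow> 'a set \<Rightarrow> bool" where
  "path_connected_in A S \<longleftrightarrow> (\<forall>x\<in>S. \<forall>y\<in>S. \<exists>vs. vs \<noteq> [] \<and> distinct vs \<and> set vs \<subseteq> S \<and>
     hd vs = x \<and> last vs = y \<and> successively A vs)"

lemma path_connected_in_insert:
  assumes S: "path_connected_in A S" and sym: "\<And>x y. A x y \<Longrightarrow> A y x"
    and r: "r \<in> S" "A s r" and s: "s \<notin> S"
  shows "path_connected_in A (insert s S)"
  unfolding path_connected_in_def
proof (intro ballI)
  fix x y assume xy: "x \<in> insert s S" "y \<in> insert s S"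
  let ?P = "\<lambda>vs. vs \<noteq> [] \<and> distinct vs \<and> set vs \<subseteq> insert s S \<and> hd vs = x \<and> last vs = y \<and> successively A vs"
  consider "x = s" "y = s" | "x = s" "y \<in> S" | "x \<in> S" "y = s" | "x \<in> S" "y \<in> S"
    using xy by blast
  then show "\<exists>vs. ?P vs"
  proof cases
    case 1
    then have "?P [s]" by simp
    then show ?thesis by blast
  next
    case 2
    then obtain vs where "vs \<noteq> []" "distinct vs" "set vs \<subseteq> S" "hd vs = r" "last vs = y" "successively A vs"
      using S r unfolding path_connected_in_def by blast
    then have "?P (s # vs)" using r s 2 by (auto simp: successively_Cons)
    then show ?thesis by blast
  next
    case 3
    then obtain vs where "vs \<noteq> []" "distinct vs" "set vs \<subseteq> S" "hd vs = x" "last vs = r" "successively A vs"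
      using S r unfolding path_connected_in_def by blast
    then have "?P (vs @ [s])" using sym[OF r(2)] s 3 by (auto simp: successively_append_iff)
    then show ?thesis by blast
  next
    case 4
    then obtain vs where "vs \<noteq> []" "distinct vs" "set vs \<subseteq> S" "hd vs = x" "last vs = y" "successively A vs"
      using S r unfolding path_connected_in_def by blast
    then have "?P vs" by blast
    then show ?thesis by blast
  qed
qed

text \<open>
  A path in \<open>S\<close> between two neighbours of \<open>s\<close> closes up to a cycle through \<open>s\<close>.
\<close>

lemma acyclic_unique_neighbour:
  assumes S: "path_connected_in A S" "S \<subseteq> V" and sym: "\<And>x y. A x y \<Longrightarrow> A y x"
    and acyclic: "\<not> (\<exists>vs. length vs \<ge> 3 \<and> distinct vs \<and> set vs \<subseteq> V \<and>
        (\<forall>k < length vs. A (vs ! k) (vs ! (Suc k mod length vs))))"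
    and s: "s \<in> V" "s \<notin> S" and r: "r \<in> S" "A s r" "q \<in> S" "A s q"
  shows "q = r"
proof (rule ccontr)
  assume qr: "q \<noteq> r"
  obtain vs where vs: "vs \<noteq> []" "distinct vs" "set vs \<subseteq> S" "hd vs = r" "last vs = q" "successively A vs"
    using S r unfolding path_connected_in_def by blast
  let ?c = "s # vs"
  have "length vs \<ge> 2"
  proof (rule ccontr)
    assume "\<not> ?thesis"
    then obtain a where "vs = [a]" using vs(1) by (cases vs rule: remdups_adj.cases) auto
    then show False using vs(4,5) qr by simp
  qed
  moreover have "distinct ?c" "set ?c \<subseteq> V" using vs s S(2) by auto
  moreover have "A (?c ! k) (?c ! (Suc k mod length ?c))" if k: "k < length ?c" for k
  proof -
    consider "k = 0" | "k = length vs" | j where "k = Suc j" "Suc j < length vs"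
      using k by (cases k) fastforce+
    then show ?thesis
    proof cases
      case 1
      then show ?thesis using vs(1,4) r(2) by (simp add: hd_conv_nth)
    next
      case 2
      then show ?thesis using vs(1,5) sym[OF r(4)] by (simp add: last_conv_nth nth_Cons')
    next
      case 3
      then show ?thesis using successively_nth[OF vs(6), of j] by simp
    qed
  qed
  ultimately show False using acyclic by (metis Suc_le_mono length_Cons numeral_2_eq_2 numeral_3_eq_3)
qed

lemma rtranclp_crossing:
  assumes "R\<^sup>*\<^sup>* x y" "x \<in> K" "y \<notin> K"
  shows "\<exists>u v. u \<in> K \<and> v \<notin> K \<and> R u v"
  using assms by (induction rule: rtranclp_induct) blast+

lemma growth_induct:
  assumes "finite V" "S0 \<subseteq> V" "P S0"
    and step: "\<And>S. S0 \<subseteq> S \<Longrightarrow> S \<subset> V \<Longrightarrow> P S \<Longrightarrow> \<exists>s \<in> V - S. P (insert s S)"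
  shows "P V"
proof -
  have "P V" if "S0 \<subseteq> S" "S \<subseteq> V" "P S" for S
    using that
  proof (induction "card (V - S)" arbitrary: S rule: less_induct)
    case less
    show ?case
    proof (cases "S = V")
      case False
      then obtain s where s: "s \<in> V - S" "P (insert s S)" using step[of S] less.prems by blast
      have "card (V - insert s S) < card (V - S)"
        by (rule psubset_card_mono) (use assms(1) s in auto)
      then show ?thesis using less.hyps[of "insert s S"] less.prems s by blast
    qed (use less.prems in simp)
  qed
  then show ?thesis using assms by blast
qed

section \<open>Intersection graphs of connected tree diagrams\<close>

lemma linked_sym: "linked_chords D v w \<Longrightarrow> linked_chords D w v"
  unfolding linked_chords_def by blast

lemma linked_in_chords: "linked_chords D v w \<Longrightarrow> v \<in> chords D \<and> w \<in> chords D"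
  unfolding linked_chords_def reduced_edge_def by blast

lemma adjacent_iff_linked: "adjacent (intersection_graph D) v w \<longleftrightarrow> linked_chords D v w"
  unfolding adjacent_def intersection_graph_def linked_chords_def
  by (auto simp: doubleton_eq_iff)

lemma tree_acyclic:
  assumes "tree_diagram D"
  shows "\<not> (\<exists>vs. length vs \<ge> 3 \<and> distinct vs \<and> set vs \<subseteq> chords D \<and>
        (\<forall>k < length vs. linked_chords D (vs ! k) (vs ! (Suc k mod length vs))))"
  using assms unfolding tree_diagram_def is_tree_def is_cycle_def adjacent_iff_linked
  by (simp add: intersection_graph_def)

lemma tree_connected:
  assumes "tree_diagram D" "v \<in> chords D" "w \<in> chords D"
  shows "(linked_chords D)\<^sup>*\<^sup>* v w"
proof -
  have "adjacent (intersection_graph D) = linked_chords D"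
    by (intro ext) (rule adjacent_iff_linked)
  then show ?thesis
    using assms unfolding tree_diagram_def is_tree_def by (simp add: intersection_graph_def)
qed

text \<open>
  A chain of chords that leaves a set of components contains a chord that leaves it.
\<close>

lemma joined_crossing:
  assumes D: "is_chord_diagram n D" "connected_diagram D"
    and "i < n" "i \<in> K" "j < n" "j \<notin> K"
  obtains c where "c \<in> cross_chords D" "label D c \<inter> K \<noteq> {}" "\<not> label D c \<subseteq> K"
proof -
  have "(joined D)\<^sup>*\<^sup>* i j"
    using assms unfolding connected_diagram_def is_chord_diagram_def by blast
  from rtranclp_crossing[OF this assms(4,6)]
  obtain k l where kl: "k \<in> K" "l \<notin> K" "joined D k l" by blast
  then obtain c where c: "c \<in> chords D" "k \<in> label D c" "l \<in> label D c"
    unfolding joined_def by blast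
  have "card (label D c) = 2"
    by (rule label_cases[OF D(1) c(1)]) (use c kl in auto)
  then show thesis using that[of c] c kl unfolding cross_chords_def by blast
qed

text \<open>
  Here three components are needed: some chord \<open>d\<close> leads from the two components of \<open>c\<close> to a third one.
  It shares exactly one component with every chord of the label of \<open>c\<close>, so it is adjacent to all of them.
\<close>

lemma linked_third_chord:
  assumes D: "is_chord_diagram n D" "connected_diagram D" and n: "n > 2"
    and c: "c \<in> cross_chords D"
  obtains d where "d \<in> cross_chords D"
    "\<And>a. a \<in> cross_chords D \<Longrightarrow> label D a = label D c \<Longrightarrow> linked_chords D a d" "label D d \<noteq> label D c"
proof -
  have "card (label D c) = 2" using c unfolding cross_chords_def by simp
  then have "\<not> {..<n} \<subseteq> label D c"
    using n card_mono[OF finite_label, of "{..<n}" D c] by auto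
  then obtain j where j: "j < n" "j \<notin> label D c" by auto
  obtain i where "i \<in> label D c" using \<open>card (label D c) = 2\<close> by fastforce
  moreover have "i < n" using calculation D(1) unfolding label_eq is_chord_diagram_def by simp
  ultimately obtain d where d: "d \<in> cross_chords D" "label D d \<inter> label D c \<noteq> {}" "\<not> label D d \<subseteq> label D c"
    using joined_crossing[OF D] j by metis
  show thesis
  proof (rule that[OF d(1)])
    fix a assume "a \<in> cross_chords D" "label D a = label D c"
    then show "linked_chords D a d"
      using d by (intro linked_different_label[OF D(1)]) auto
  qed (use d in auto)
qed

text \<open>
  Some chord \<open>s\<close> outside \<open>S\<close> shares a component with a chord \<open>c\<close> in \<open>S\<close>. If their labels differ, they are
  adjacent. Otherwise the chord \<open>d\<close> of \<open>linked_third_chord\<close> is adjacent to both, and either \<open>d\<close> is in \<open>S\<close>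
  and \<open>s\<close> is adjacent to it, or \<open>d\<close> itself is the chord to add.
\<close>

lemma cross_chords_growth:
  assumes D: "is_chord_diagram n D" "connected_diagram D" and n: "n > 2"
    and S: "S \<noteq> {}" "S \<subset> cross_chords D"
  obtains s r where "s \<in> cross_chords D" "s \<notin> S" "r \<in> S" "linked_chords D s r"
proof -
  let ?K = "\<Union>c\<in>S. label D c"
  have lab: "label D c \<subseteq> {..<n}" "label D c \<noteq> {}" if "c \<in> cross_chords D" for c
    using that D(1) label_nonempty[OF D(1), of c]
    unfolding cross_chords_def is_chord_diagram_def by (auto simp: label_eq)
  have "\<exists>s \<in> cross_chords D - S. label D s \<inter> ?K \<noteq> {}"
  proof (rule ccontr)
    assume no: "\<not> ?thesis"
    obtain s where s: "s \<in> cross_chords D - S" using S(2) by blast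
    then obtain j where j: "j \<in> label D s" "j < n" "j \<notin> ?K" using lab[of s] no by blast
    obtain c where c: "c \<in> S" using S(1) by blast
    then obtain i where i: "i \<in> label D c" "i < n" "i \<in> ?K" using lab[of c] S(2) by blast
    obtain d where "d \<in> cross_chords D" "label D d \<inter> ?K \<noteq> {}" "\<not> label D d \<subseteq> ?K"
      using joined_crossing[OF D i(2,3) j(2,3)] by blast
    then show False using no by blast
  qed
  then obtain s c where s: "s \<in> cross_chords D" "s \<notin> S" and c: "c \<in> S" "label D s \<inter> label D c \<noteq> {}"
    by blast
  have cC: "c \<in> cross_chords D" using c(1) S(2) by blast
  show thesis
  proof (cases "label D s = label D c")
    case False
    then show thesis using that[OF s c(1)] linked_different_label[OF D(1) s(1) cC] c(2) by blast
  next
    case True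
    obtain d where d: "d \<in> cross_chords D"
        "\<And>a. a \<in> cross_chords D \<Longrightarrow> label D a = label D c \<Longrightarrow> linked_chords D a d"
      using linked_third_chord[OF D n cC] by metis
    show thesis
    proof (cases "d \<in> S")
      case True
      then show thesis using that[OF s True d(2)[OF s(1) \<open>label D s = label D c\<close>]] by blast
    next
      case False
      then show thesis using that[OF d(1) False c(1) linked_sym[OF d(2)[OF cC refl]]] by blast
    qed
  qed
qed

lemma finite_chords: "finite (chords D)"
  unfolding chords_def by simp

lemma cross_chords_nonempty:
  assumes D: "is_chord_diagram n D" "connected_diagram D" and n: "n > 2"
  shows "cross_chords D \<noteq> {}"
  using joined_crossing[OF D, of 0 "{0}" 1] n by auto

lemma cross_chords_path_connected:
  assumes D: "is_chord_diagram n D" "connected_diagram D" and n: "n > 2"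
  shows "path_connected_in (linked_chords D) (cross_chords D)"
proof -
  let ?C = "cross_chords D"
  obtain c0 where c0: "c0 \<in> ?C" using cross_chords_nonempty[OF assms] by blast
  show ?thesis
  proof (rule growth_induct[of ?C "{c0}"])
    show "finite ?C" using finite_chords[of D] unfolding cross_chords_def by simp
    show "{c0} \<subseteq> ?C" using c0 by simp
    have "[c0] \<noteq> [] \<and> distinct [c0] \<and> set [c0] \<subseteq> {c0} \<and> hd [c0] = c0 \<and> last [c0] = c0
        \<and> successively (linked_chords D) [c0]" by simp
    then show "path_connected_in (linked_chords D) {c0}"
      unfolding path_connected_in_def by blast
  next
    fix S assume S: "{c0} \<subseteq> S" "S \<subset> ?C" "path_connected_in (linked_chords D) S"
    then have "S \<noteq> {}" by blast
    from cross_chords_growth[OF D n this S(2)]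
    obtain s r where s: "s \<in> ?C" "s \<notin> S" "r \<in> S" "linked_chords D s r" .
    have "path_connected_in (linked_chords D) (insert s S)"
      by (rule path_connected_in_insert[OF S(3) linked_sym s(3,4,2)])
    then show "\<exists>s\<in>?C - S. path_connected_in (linked_chords D) (insert s S)" using s by blast
  qed
qed

text \<open>
  Two adjacent chords with equal labels would form a triangle with the chord of \<open>linked_third_chord\<close>.
\<close>

lemma equal_labels_not_linked:
  assumes D: "is_chord_diagram n D" "connected_diagram D" "tree_diagram D" and n: "n > 2"
    and ab: "a \<in> cross_chords D" "b \<in> cross_chords D" "label D a = label D b"
  shows "\<not> linked_chords D a b"
proof
  assume l: "linked_chords D a b"
  obtain d where d: "d \<in> cross_chords D"
      "\<And>c. c \<in> cross_chords D \<Longrightarrow> label D c = label D b \<Longrightarrow> linked_chords D c d" "label D d \<noteq> label D b"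
    using linked_third_chord[OF D(1,2) n ab(2)] by metis
  have ad: "linked_chords D a d" and bd: "linked_chords D b d" using d ab by auto
  have "a \<noteq> b" using l unfolding linked_chords_def reduced_edge_def by auto
  then have "distinct [a, b, d]" using d ab by auto
  moreover have "set [a, b, d] \<subseteq> chords D" using d ab unfolding cross_chords_def by auto
  moreover have "linked_chords D ([a, b, d] ! k) ([a, b, d] ! (Suc k mod length [a, b, d]))"
    if "k < length [a, b, d]" for k
  proof -
    have "k = 0 \<or> k = 1 \<or> k = 2" using that by auto
    then show ?thesis using l bd linked_sym[OF ad] by (auto simp: numeral_2_eq_2)
  qed
  moreover have "length [a, b, d] \<ge> 3" by simp
  ultimately show False using tree_acyclic[OF D(3)] by blast
qed

section \<open>Tree diagrams under weight systems\<close>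

lemma distinct_if_count_le_1:
  "(\<And>c. c \<in> set l \<Longrightarrow> count_list l c \<le> 1) \<Longrightarrow> distinct l"
proof (induction l)
  case (Cons x l)
  have "count_list l x = 0" using Cons.prems[of x] by simp
  then have "x \<notin> set l" unfolding count_list_0_iff .
  moreover have "distinct l"
  proof (rule Cons.IH)
    fix c assume "c \<in> set l"
    then show "count_list l c \<le> 1" using Cons.prems[of c] by (auto split: if_splits)
  qed
  ultimately show ?case by simp
qed simp

text \<open>
  The label function is a parameter so that both diagrams can be compared over the same one.
\<close>

lemma skeleton_restrict:
  assumes D: "is_chord_diagram n D" and C: "C = cross_chords D"
    and par: "\<And>a b. a \<in> C \<Longrightarrow> b \<in> C \<Longrightarrow> label D a = label D b \<Longrightarrow> \<not> reduced_edge D a b"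
    and lab: "\<And>c. c \<in> C \<Longrightarrow> lab c = label D c"
  shows "skeleton lab C (restrict_chords C D)"
  unfolding skeleton_def
proof (intro conjI allI impI ballI)
  fix k assume "k < length (restrict_chords C D)"
  then have k: "k < length D" unfolding restrict_chords_def by simp
  have nth: "restrict_chords C D ! k = filter (\<lambda>c. c \<in> C) (D ! k)"
    using k unfolding restrict_chords_def by simp
  show "distinct (restrict_chords C D ! k)"
    unfolding nth
    by (rule distinct_if_count_le_1)
      (use count_cross_chord[OF D _ _ k] C in \<open>auto simp: count_list_filter cross_chords_def\<close>)
  show "set (restrict_chords C D ! k) = {c \<in> C. k \<in> lab c}"
    unfolding nth using k lab by (auto simp: label_eq)
next
  fix p q k l assume *: "p \<in> C" "q \<in> C" "lab p = lab q" "k \<in> lab p" "l \<in> lab p"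
  then have eq: "label D p = label D q" and kl: "k \<in> label D p" "l \<in> label D p" using lab by auto
  have "k < length D" "l < length D" using kl unfolding label_eq by auto
  then have nth: "restrict_chords C D ! k = filter (\<lambda>c. c \<in> C) (D ! k)"
      "restrict_chords C D ! l = filter (\<lambda>c. c \<in> C) (D ! l)"
    unfolding restrict_chords_def by simp_all
  show "before (restrict_chords C D ! k) p q \<longleftrightarrow> before (restrict_chords C D ! l) p q"
    unfolding nth before_filter
    using parallel_if_not_linked[OF D, of p q k l] * C eq kl par[OF *(1,2) eq] by auto
qed

lemma restrict_all_chords: "restrict_chords (chords D) D = D"
  unfolding restrict_chords_def by (auto intro!: map_idI filter_True simp: chords_def)

text \<open>
  The subdiagrams grow from the chords that join two components. The claim of each stage is made for all
  weight systems at once, because the step for \<open>\<phi>\<close> uses the previous stage for \<open>attach_leaf \<phi>\<close>.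
  Connectedness of the stage is what makes the neighbour of the next chord unique.
\<close>

lemma weight_system_tree_diagrams:
  assumes n: "n > 2" and D: "is_chord_diagram n D" "connected_diagram D" "tree_diagram D"
    and E: "is_chord_diagram n E" "chords E = chords D"
    and lab: "\<And>v. v \<in> chords D \<Longrightarrow> label E v = label D v"
    and edge: "\<And>v w. v \<in> chords D \<Longrightarrow> w \<in> chords D \<Longrightarrow> reduced_edge E v w \<longleftrightarrow> reduced_edge D v w"
    and ws: "weight_system \<phi>"
  shows "\<phi> (flat D) = \<phi> (flat E)"
proof -
  let ?C = "cross_chords D" and ?V = "chords D" and ?A = "linked_chords D"
  define P where "P = (\<lambda>S. path_connected_in ?A S \<and>
    (\<forall>\<phi>. weight_system \<phi> \<longrightarrow> \<phi> (flat (restrict_chords S D)) = \<phi> (flat (restrict_chords S E))))"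
  have CV: "?C \<subseteq> ?V" unfolding cross_chords_def by blast
  have CE: "cross_chords E = ?C" unfolding cross_chords_def E(2) using lab by auto
  have linkedE: "linked_chords E v w \<longleftrightarrow> ?A v w" if "v \<in> ?V" "w \<in> ?V" for v w
    unfolding linked_chords_def using edge that by simp
  have len: "length D = n" "length E = n" using D(1) E(1) unfolding is_chord_diagram_def by auto
  have nl: "\<not> ?A a b" if "a \<in> ?C" "b \<in> ?C" "label D a = label D b" for a b
    by (rule equal_labels_not_linked[OF D n that])
  have base: "P ?C"
    unfolding P_def
  proof (intro conjI allI impI)
    show "path_connected_in ?A ?C" by (rule cross_chords_path_connected[OF D(1,2) n])
    fix \<phi> :: "nat option list \<Rightarrow> real" assume ws: "weight_system \<phi>"
    show "\<phi> (flat (restrict_chords ?C D)) = \<phi> (flat (restrict_chords ?C E))"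
    proof (rule reorder_parallel_chords[OF ws, of ?C "label D"])
      show "finite ?C" using CV finite_chords finite_subset by blast
      fix c assume "c \<in> ?C"
      then show "label D c \<subseteq> {..<length (restrict_chords ?C E)} \<and> card (label D c) = 2"
        using len unfolding cross_chords_def restrict_chords_def by (auto simp: label_eq)
    next
      show "skeleton (label D) ?C (restrict_chords ?C D)"
        by (rule skeleton_restrict[OF D(1) refl]) (use nl in \<open>auto simp: linked_chords_def\<close>)
      show "skeleton (label D) ?C (restrict_chords ?C E)"
      proof (rule skeleton_restrict[OF E(1) CE[symmetric]])
        fix a b assume ab: "a \<in> ?C" "b \<in> ?C" "label E a = label E b"
        have V: "a \<in> ?V" "b \<in> ?V" using subsetD[OF CV] ab(1,2) by simp_all
        have "label D a = label D b" using ab(3) unfolding lab[OF V(1)] lab[OF V(2)] .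
        then have "\<not> reduced_edge D a b" using nl[OF ab(1,2)] unfolding linked_chords_def by simp
        then show "\<not> reduced_edge E a b" unfolding edge[OF V] .
      next
        fix c assume "c \<in> ?C"
        then show "label D c = label E c" using lab[of c] subsetD[OF CV, of c] by simp
      qed
      show "length (restrict_chords ?C D) = length (restrict_chords ?C E)"
        using len unfolding restrict_chords_def by simp
    next
      fix k p q assume k: "k < length (restrict_chords ?C E)" and pq: "p \<in> ?C" "q \<in> ?C"
        and kp: "k \<in> label D p" and kq: "k \<in> label D q" and ne: "label D p \<noteq> label D q"
      have pqV: "p \<in> ?V" "q \<in> ?V" using pq CV by auto
      have kn: "k < n" using k len unfolding restrict_chords_def by simp
      have nth: "restrict_chords ?C D ! k = filter (\<lambda>c. c \<in> ?C) (D ! k)"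
          "restrict_chords ?C E ! k = filter (\<lambda>c. c \<in> ?C) (E ! k)"
        using kn len unfolding restrict_chords_def by simp_all
      have "before (D ! k) p q \<longleftrightarrow> reduced_edge D p q"
        using reduced_edge_different_label[OF D(1) pq ne kp kq] by simp
      also have "\<dots> \<longleftrightarrow> reduced_edge E p q" using edge[OF pqV] by simp
      also have "\<dots> \<longleftrightarrow> before (E ! k) p q"
        using reduced_edge_different_label[OF E(1), of p q k] pq ne kp kq lab[OF pqV(1)] lab[OF pqV(2)] CE
        by auto
      finally show "before (restrict_chords ?C D ! k) p q \<longleftrightarrow> before (restrict_chords ?C E ! k) p q"
        unfolding nth before_filter using pq by simp
    qed
  qed
  have "P ?V"
  proof (rule growth_induct[of ?V ?C])
    show "finite ?V" by (rule finite_chords)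
    fix S assume S: "?C \<subseteq> S" "S \<subset> ?V" "P S"
    obtain c0 where c0: "c0 \<in> S" using cross_chords_nonempty[OF D(1,2) n] S(1) by blast
    obtain v where v: "v \<in> ?V" "v \<notin> S" using S(2) by blast
    have "?A\<^sup>*\<^sup>* c0 v" using tree_connected[OF D(3)] c0 v S(2) by blast
    from rtranclp_crossing[OF this c0 v(2)]
    obtain r s where "r \<in> S" "s \<notin> S" "?A r s" by blast
    then have rs: "r \<in> S" "s \<notin> S" "?A s r" by (auto intro: linked_sym)
    have sV: "s \<in> ?V" using linked_in_chords[OF rs(3)] by blast
    obtain i where i: "label D s = {i}"
      by (rule label_cases[OF D(1) sV]) (use rs(2) S(1) sV in \<open>auto simp: cross_chords_def\<close>)
    have pc: "path_connected_in ?A S" using S(3) unfolding P_def by blast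
    have unique: "c = r" if "c \<in> S" "?A s c" for c
      using acyclic_unique_neighbour[OF pc _ linked_sym tree_acyclic[OF D(3)] sV rs(2,1,3) that] S(2)
      by blast
    have "P (insert s S)"
      unfolding P_def
    proof (intro conjI allI impI)
      show "path_connected_in ?A (insert s S)"
        by (rule path_connected_in_insert[OF pc linked_sym rs(1,3,2)])
      fix \<phi> :: "nat option list \<Rightarrow> real" assume ws: "weight_system \<phi>"
      have SV: "S \<subseteq> ?V" using S(2) by blast
      have ne: "s \<noteq> r" using rs by blast
      have "\<phi> (flat (restrict_chords (insert s S) D)) = attach_leaf \<phi> s r i (flat (restrict_chords S D))"
        by (rule flat_insert_self_chord[OF ws D(1) sV i rs(2) SV rs(1,3) unique])
      also have "\<dots> = attach_leaf \<phi> s r i (flat (restrict_chords S E))"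
        using S(3) weight_system_attach_leaf[OF ws ne] unfolding P_def by blast
      also have "\<dots> = \<phi> (flat (restrict_chords (insert s S) E))"
      proof (rule flat_insert_self_chord[OF ws E(1), symmetric])
        show "s \<in> chords E" "label E s = {i}" "s \<notin> S" "S \<subseteq> chords E" "r \<in> S"
          using sV E(2) lab[OF sV] i rs SV by auto
        show "linked_chords E s r" using linkedE[OF sV] rs SV by blast
        show "c = r" if "c \<in> S" "linked_chords E s c" for c
          using unique[of c] linkedE[OF sV] that SV by blast
      qed
      finally show "\<phi> (flat (restrict_chords (insert s S) D)) = \<phi> (flat (restrict_chords (insert s S) E))" .
    qed
    then show "\<exists>s\<in>?V - S. P (insert s S)" using sV rs(2) by blast
  qed (use CV base in auto)
  then have "\<phi> (flat (restrict_chords ?V D)) = \<phi> (flat (restrict_chords ?V E))"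
    using ws unfolding P_def by blast
  moreover have "restrict_chords ?V D = D" "restrict_chords ?V E = E"
    using restrict_all_chords[of D] restrict_all_chords[of E] E(2) by simp_all
  ultimately show ?thesis by simp
qed

section \<open>From weight systems to the span of the relators\<close>

text \<open>
  A left inverse of \<open>flat\<close>, defined on all words so that functions on diagrams become functions on words.
\<close>

primrec split_components :: "'a option list \<Rightarrow> 'a list list" where
  "split_components [] = [[]]"
| "split_components (x # xs) = (case x of
      None \<Rightarrow> [] # split_components xs
    | Some a \<Rightarrow> (a # hd (split_components xs)) # tl (split_components xs))"

lemma split_components_nonempty: "split_components xs \<noteq> []"
  by (cases xs) (auto split: option.split)

lemma length_split_components: "length (split_components xs) = Suc (count_list xs None)"
  by (induction xs) (auto split: option.split)

lemma split_components_append: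
  "split_components (map Some w @ xs) = (w @ hd (split_components xs)) # tl (split_components xs)"
  by (induction w) (auto simp: split_components_nonempty)

lemma count_list_concat_split: "count_list (concat (split_components xs)) c = count_list xs (Some c)"
proof (induction xs)
  case (Cons x xs)
  obtain w ws where "split_components xs = w # ws"
    using split_components_nonempty by (cases "split_components xs") auto
  then show ?case using Cons by (auto split: option.split)
qed simp

lemma split_components_flat:
  assumes "D \<noteq> []"
  shows "split_components (flat D) = D"
proof -
  obtain w D' where D: "D = w # D'" using assms by (cases D) auto
  have "split_components (map Some v @ concat (map (\<lambda>w. None # map Some w) L)) = v # L" for v and L :: "'a list list"
    by (induction L arbitrary: v) (use split_components_append[of _ "[]"] in \<open>auto simp: split_components_append\<close>)
  then show ?thesis unfolding D flat_def by simp
qed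

lemma fill_split_components:
  "fill (split_components M) p q r
     = split_components (concat (map (\<lambda>x. case x of None \<Rightarrow> [None] | Some s \<Rightarrow> map Some (fill_slot p q r s)) M))"
proof (induction M)
  case (Cons x M)
  obtain w ws where w: "split_components M = w # ws"
    using split_components_nonempty by (cases "split_components M") auto
  show ?case
  proof (cases x)
    case None
    then show ?thesis using Cons by (simp add: fill_def)
  next
    case (Some s)
    then show ?thesis using Cons[symmetric] w by (simp add: fill_def split_components_append)
  qed
qed (simp add: fill_def)

text \<open>
  The template is found by replacing the two displayed positions of \<open>a\<close> by the arcs \<open>Alpha\<close> and \<open>Beta\<close>
  and the remaining end of \<open>e\<close>, wherever it is, by \<open>Gamma\<close>.
\<close>

lemma four_term_relator_flat:
  fixes u z w :: "nat option list" and a e :: nat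
  assumes ae: "a \<noteq> e" and W: "is_chord_diagram n (split_components (u @ [Some a, Some e] @ z @ [Some a] @ w))"
  shows "diagram_vec (split_components (u @ [Some a, Some e] @ z @ [Some a] @ w))
    - diagram_vec (split_components (u @ [Some e, Some a] @ z @ [Some a] @ w))
    + diagram_vec (split_components (u @ [Some a] @ z @ [Some a, Some e] @ w))
    - diagram_vec (split_components (u @ [Some a] @ z @ [Some e, Some a] @ w)) \<in> four_term_relators n"
proof -
  let ?W = "u @ [Some a, Some e] @ z @ [Some a] @ w"
  define \<sigma> where "\<sigma> = map_option (\<lambda>c. if c = e then Gamma else Chord c)"
  define M where "M = map \<sigma> u @ [Some Alpha] @ map \<sigma> z @ [Some Beta] @ map \<sigma> w"
  have cW: "Some c \<in> set ?W \<Longrightarrow> count_list ?W (Some c) = 2" for c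
    using W unfolding is_chord_diagram_def
    by (metis count_list_0_iff count_list_concat_split)
  have ca: "count_list u (Some a) = 0" "count_list z (Some a) = 0" "count_list w (Some a) = 0"
    using cW[of a] ae by auto
  have ce: "count_list u (Some e) + count_list z (Some e) + count_list w (Some e) = 1"
    using cW[of e] ae by simp
  have s0: "count_list (map \<sigma> x) (Some Alpha) = 0" "count_list (map \<sigma> x) (Some Beta) = 0"
    "count_list (map \<sigma> x) (Some Gamma) = count_list x (Some e)"
    "count_list (map \<sigma> x) (Some (Chord c)) = (if c = e then 0 else count_list x (Some c))"
    "count_list (map \<sigma> x) None = count_list x None" for x c
    by (induction x) (auto simp: \<sigma>_def)
  have template: "is_template n (split_components M)"
    unfolding is_template_def
  proof (intro conjI allI impI)
    have "length (split_components ?W) = n" using W unfolding is_chord_diagram_def by simp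
    then show "length (split_components M) = n"
      unfolding length_split_components M_def by (simp add: s0)
    show "count_list (concat (split_components M)) Alpha = 1"
      "count_list (concat (split_components M)) Beta = 1"
      "count_list (concat (split_components M)) Gamma = 1"
      unfolding count_list_concat_split M_def using ce by (simp_all add: s0)
    fix c assume "Chord c \<in> set (concat (split_components M))"
    then have "count_list (concat (split_components M)) (Chord c) \<noteq> 0"
      unfolding count_list_0_iff by simp
    then have nz: "count_list M (Some (Chord c)) \<noteq> 0" unfolding count_list_concat_split .
    then have c: "c \<noteq> e" "c \<noteq> a" using ca unfolding M_def by (auto simp: s0 split: if_splits)
    then have eq: "count_list M (Some (Chord c)) = count_list ?W (Some c)"
      unfolding M_def by (simp add: s0)
    then have "Some c \<in> set ?W" using nz count_list_0_iff[of ?W "Some c"] by metis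
    then show "count_list (concat (split_components M)) (Chord c) = 2"
      unfolding count_list_concat_split eq by (rule cW)
  qed
  have fresh: "Chord a \<notin> set (concat (split_components M))" "Chord e \<notin> set (concat (split_components M))"
    unfolding count_list_0_iff[symmetric] count_list_concat_split M_def using ca by (simp_all add: s0)
  have unsubst: "concat (map (\<lambda>x. case x of None \<Rightarrow> [None] | Some s \<Rightarrow> map Some (fill_slot p q [e] s)) (map \<sigma> x)) = x"
    for x p q by (induction x) (auto simp: \<sigma>_def split: option.split)
  have fill: "fill (split_components M) p q [e] = split_components (u @ map Some p @ z @ map Some q @ w)" for p q
    unfolding fill_split_components unfolding M_def map_append concat_append unsubst by simp
  show ?thesis
    unfolding four_term_relators_def
    using template fresh ae fill[of "[a, e]" "[a]"] fill[of "[e, a]" "[a]"]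
      fill[of "[a]" "[a, e]"] fill[of "[a]" "[e, a]"]
    by (intro CollectI exI[of _ "split_components M"] exI[of _ a] exI[of _ e]) simp
qed

lemma weight_system_of_functional:
  fixes F :: "diagram_space \<Rightarrow> real"
  assumes F: "linear F" and zero: "\<And>x. x \<in> four_term_relators n \<Longrightarrow> F x = 0"
  shows "weight_system (\<lambda>xs. if is_chord_diagram n (split_components xs)
     then F (diagram_vec (split_components xs)) else 0)"
  unfolding weight_system_def
proof (intro allI impI)
  fix u z w :: "nat option list" and a e :: nat
  assume ae: "a \<noteq> e"
  let ?s = split_components
  define W1 where "W1 = u @ [Some a, Some e] @ z @ [Some a] @ w"
  define W2 where "W2 = u @ [Some e, Some a] @ z @ [Some a] @ w"
  define W3 where "W3 = u @ [Some a] @ z @ [Some a, Some e] @ w"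
  define W4 where "W4 = u @ [Some a] @ z @ [Some e, Some a] @ w"
  have diag: "is_chord_diagram n (?s xs) \<longleftrightarrow>
      Suc (count_list xs None) = n \<and> (\<forall>c. count_list xs (Some c) \<noteq> 0 \<longrightarrow> count_list xs (Some c) = 2)" for xs
    unfolding is_chord_diagram_def length_split_components count_list_concat_split[symmetric] Ball_def
    by (simp only: count_list_0_iff not_not)
  have cnt: "count_list W2 x = count_list W1 x" "count_list W3 x = count_list W1 x"
    "count_list W4 x = count_list W1 x" for x
    by (simp_all add: W1_def W2_def W3_def W4_def)
  have same: "is_chord_diagram n (?s W2) = is_chord_diagram n (?s W1)"
    "is_chord_diagram n (?s W3) = is_chord_diagram n (?s W1)"
    "is_chord_diagram n (?s W4) = is_chord_diagram n (?s W1)"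
    unfolding diag cnt by (rule refl)+
  have "F (diagram_vec (?s W1)) - F (diagram_vec (?s W2)) + F (diagram_vec (?s W3)) - F (diagram_vec (?s W4)) = 0"
    if "is_chord_diagram n (?s W1)"
  proof -
    have "diagram_vec (?s W1) - diagram_vec (?s W2) + diagram_vec (?s W3) - diagram_vec (?s W4)
        \<in> four_term_relators n"
      using that unfolding W1_def W2_def W3_def W4_def by (rule four_term_relator_flat[OF ae])
    from zero[OF this] show ?thesis by (simp add: linear_add[OF F] linear_diff[OF F])
  qed
  then show "(if is_chord_diagram n (?s (u @ [Some a, Some e] @ z @ [Some a] @ w))
       then F (diagram_vec (?s (u @ [Some a, Some e] @ z @ [Some a] @ w))) else 0) -
      (if is_chord_diagram n (?s (u @ [Some e, Some a] @ z @ [Some a] @ w))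
       then F (diagram_vec (?s (u @ [Some e, Some a] @ z @ [Some a] @ w))) else 0) +
      (if is_chord_diagram n (?s (u @ [Some a] @ z @ [Some a, Some e] @ w))
       then F (diagram_vec (?s (u @ [Some a] @ z @ [Some a, Some e] @ w))) else 0) -
      (if is_chord_diagram n (?s (u @ [Some a] @ z @ [Some e, Some a] @ w))
       then F (diagram_vec (?s (u @ [Some a] @ z @ [Some e, Some a] @ w))) else 0) = 0"
    unfolding W1_def[symmetric] W2_def[symmetric] W3_def[symmetric] W4_def[symmetric] same by simp
qed

lemma separating_functional:
  fixes x :: "'v::real_vector"
  assumes "x \<notin> span R"
  obtains F :: "'v \<Rightarrow> real" where "linear F" "\<forall>y\<in>span R. F y = 0" "F x = 1"
proof -
  obtain B where B: "B \<subseteq> span R" "independent B" "span R \<subseteq> span B"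
    using maximal_independent_subset[of "span R"] by blast
  have "span B \<subseteq> span R" using span_minimal[OF B(1)] subspace_span by blast
  then have "x \<notin> span B" using assms by blast
  then have ind: "independent (insert x B)" using B(2) by (simp add: independent_insert)
  obtain F :: "'v \<Rightarrow> real" where F: "linear F" "\<forall>y\<in>insert x B. F y = (if y = x then 1 else 0)"
    using linear_independent_extend[OF ind, of "\<lambda>y. if y = x then 1 else 0"] by blast
  have "x \<notin> B" using \<open>x \<notin> span B\<close> span_base by blast
  have "F y = 0" if "y \<in> span R" for y
  proof (rule linear_eq_0_on_span[OF F(1)])
    show "y \<in> span B" using that B(3) by blast
    show "F b = 0" if "b \<in> B" for b using F(2) that \<open>x \<notin> B\<close> by auto
  qed
  then show thesis using that F by simp
qed

section \<open>Renaming chords\<close>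

lemma chords_rename: "chords (map (map h) D) = h ` chords D"
  unfolding chords_def by auto

lemma count_list_map_inj:
  "inj_on h (insert c (set l)) \<Longrightarrow> count_list (map h l) (h c) = count_list l c"
  by (induction l) (auto simp: inj_on_def)

lemma is_chord_diagram_rename:
  assumes "inj_on h (chords D)" "is_chord_diagram n D"
  shows "is_chord_diagram n (map (map h) D)"
proof -
  have "count_list (concat (map (map h) D)) (h c) = 2" if "c \<in> set (concat D)" for c
  proof -
    have "inj_on h (insert c (set (concat D)))"
      using assms(1) that unfolding chords_def by (simp add: insert_absorb)
    then have "count_list (map h (concat D)) (h c) = count_list (concat D) c"
      by (rule count_list_map_inj)
    then show ?thesis using assms(2) that unfolding is_chord_diagram_def map_concat by metis
  qed
  then show ?thesis using assms(2) unfolding is_chord_diagram_def by auto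
qed

lemma endpoints_rename:
  assumes "inj_on h (chords D)" "c \<in> chords D"
  shows "endpoints (map (map h) D) (h c) = endpoints D c"
proof -
  have "D ! i ! p \<in> chords D" if "i < length D" "p < length (D ! i)" for i p
    using that unfolding chords_def by (auto intro!: bexI[of _ "D ! i"])
  then have "h (D ! i ! p) = h c \<longleftrightarrow> D ! i ! p = c" if "i < length D" "p < length (D ! i)" for i p
    using that inj_on_eq_iff[OF assms(1) _ assms(2)] by blast
  then show ?thesis unfolding endpoints_def by auto
qed

lemma reduced_edge_rename:
  assumes "inj_on h (chords D)" "v \<in> chords D" "w \<in> chords D"
  shows "reduced_edge (map (map h) D) (h v) (h w) \<longleftrightarrow> reduced_edge D v w"
  using assms endpoints_rename[OF assms(1)] inj_on_eq_iff[OF assms(1)]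
  unfolding reduced_edge_def multiplicity_edge_def chords_rename by simp

text \<open>
  Renaming does not change the diagram, so the graph isomorphism may be taken to be the identity.
\<close>

lemma diagram_class_rename:
  assumes "inj_on h (chords D)"
  shows "diagram_class (map (map h) D) = diagram_class D"
proof (intro equalityI subsetI)
  fix X assume "X \<in> diagram_class (map (map h) D)"
  then obtain f where f: "X = map (map f) (map (map h) D)" "inj_on f (h ` chords D)"
    unfolding diagram_class_def chords_rename by blast
  then have "X = map (map (f \<circ> h)) D" "inj_on (f \<circ> h) (chords D)"
    using comp_inj_on[OF assms] by auto
  then show "X \<in> diagram_class D" unfolding diagram_class_def by blast
next
  fix X assume "X \<in> diagram_class D"
  then obtain f where f: "X = map (map f) D" "inj_on f (chords D)"
    unfolding diagram_class_def by blast
  define g where "g = f \<circ> inv_into (chords D) h"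
  have "f c = g (h c)" if "c \<in> chords D" for c
    using that assms by (simp add: g_def)
  then have "X = map (map g) (map (map h) D)"
    unfolding f(1) chords_def by auto
  moreover have "inj_on g (h ` chords D)"
    unfolding g_def using f(2) inj_on_inv_into[of "h ` chords D" h "chords D"]
    by (intro comp_inj_on) (simp_all add: inv_into_image_cancel[OF assms])
  ultimately show "X \<in> diagram_class (map (map h) D)"
    unfolding diagram_class_def chords_rename by blast
qed

lemma reduced_edge_iff_graph:
  "reduced_edge D v w \<longleftrightarrow> (v, w) \<in> dir_edges (intersection_graph D) \<or> {v, w} \<in> undir_edges (intersection_graph D)"
  unfolding intersection_graph_def by (auto simp: doubleton_eq_iff)

theorem theorem3:
  fixes n :: nat and D1 D2 :: word_system
  assumes "n > 2"
    and "is_chord_diagram n D1" and "connected_diagram D1" and "tree_diagram D1"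
    and "is_chord_diagram n D2" and "connected_diagram D2" and "tree_diagram D2"
    and "graph_iso (intersection_graph D1) (intersection_graph D2)"
  shows "equivalent_mod_relations n D1 D2"
proof -
  obtain f where f: "bij_betw f (chords D1) (chords D2)"
    and flab: "\<And>v. v \<in> chords D1 \<Longrightarrow> label D2 (f v) = label D1 v"
    and fedge: "\<And>v w. v \<in> chords D1 \<Longrightarrow> w \<in> chords D1 \<Longrightarrow> reduced_edge D2 (f v) (f w) \<longleftrightarrow> reduced_edge D1 v w"
    using assms(8) unfolding graph_iso_def reduced_edge_iff_graph
    by (auto simp: intersection_graph_def)
  define h where "h = inv_into (chords D1) f"
  have h: "inj_on h (chords D2)" "h ` chords D2 = chords D1"
    using bij_betw_inv_into[OF f] unfolding h_def bij_betw_def by auto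
  have hf: "h (f v) = v" "f v \<in> chords D2" if "v \<in> chords D1" for v
    using that f unfolding h_def bij_betw_def by auto
  define E where "E = map (map h) D2"
  have vecE: "diagram_vec E = diagram_vec D2"
    unfolding diagram_vec_def E_def diagram_class_rename[OF h(1)] ..
  have E: "is_chord_diagram n E" unfolding E_def by (rule is_chord_diagram_rename[OF h(1) assms(5)])
  have cE: "chords E = chords D1" unfolding E_def chords_rename h(2) ..
  have labE: "label E v = label D1 v" if "v \<in> chords D1" for v
    using endpoints_rename[OF h(1) hf(2)[OF that]] flab[OF that] hf(1)[OF that] unfolding E_def by simp
  have edgeE: "reduced_edge E v w \<longleftrightarrow> reduced_edge D1 v w" if "v \<in> chords D1" "w \<in> chords D1" for v w
    using reduced_edge_rename[OF h(1) hf(2)[OF that(1)] hf(2)[OF that(2)]] fedge[OF that]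
      hf(1)[OF that(1)] hf(1)[OF that(2)]
    unfolding E_def by simp
  let ?R = "one_term_relators n \<union> four_term_relators n"
  have "diagram_vec D1 - diagram_vec E \<in> span ?R"
  proof (rule ccontr)
    assume "\<not> ?thesis"
    from separating_functional[OF this]
    obtain F :: "diagram_space \<Rightarrow> real" where F: "linear F" "\<forall>y\<in>span ?R. F y = 0"
      "F (diagram_vec D1 - diagram_vec E) = 1" by blast
    define \<phi> where "\<phi> = (\<lambda>xs. if is_chord_diagram n (split_components xs)
      then F (diagram_vec (split_components xs)) else 0)"
    have ws: "weight_system \<phi>"
      unfolding \<phi>_def by (rule weight_system_of_functional[OF F(1)]) (use F(2) span_base in blast)
    have "\<phi> (flat D1) = \<phi> (flat E)"
      by (rule weight_system_tree_diagrams[OF assms(1-4) E cE _ _ ws]) (use labE edgeE in blast)+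
    moreover have "D1 \<noteq> []" "E \<noteq> []"
      using assms(1,2) E unfolding is_chord_diagram_def by auto
    ultimately have "F (diagram_vec D1) = F (diagram_vec E)"
      using assms(2) E unfolding \<phi>_def by (simp add: split_components_flat)
    then show False using F(3) by (simp add: linear_diff[OF F(1)])
  qed
  then show ?thesis unfolding equivalent_mod_relations_def vecE .
qed

end
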